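(* Let $(\mathcal{X}_1,\mathcal{X}_2,\mathcal{X}_s,\omega,\mathcal{Y}_p,\mathcal{Y}_s)$ be a discrete memoryless channel as in the context and let $Z=QUWX_1X_2X_sY_pY_s\in\mathcal{P}^*$. Let $\delta^o(Z)$ be the set of all tuples $(R_1,R_2,S,T)$ of nonnegative real numbers satisfying $$R_1\le I(Y_p;X_1|WX_2Q),\quad R_2\le I(Y_p;X_2|WX_1Q),\quad T\le I(Y_p;W|X_1X_2Q),$$ $$R_1+R_2\le I(Y_p;X_1X_2|WQ),\quad T+R_1\le I(Y_p;WX_1|X_2Q),\quad T+R_2\le I(Y_p;WX_2|X_1Q),$$ $$T+R_1+R_2\le I(Y_p;WX_1X_2|Q),$$ $$S\le I(Y_s;U|WQ),\quad T\le I(Y_s;W|UQ),\quad S+T\le I(Y_s;UW|Q).$$ Then every tuple $(R_1,R_2,S,T)\in\delta^o(Z)$ is achievable for the rate-splitting channel $C_{RS}$.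
   Context: Channel. $\mathcal{X}_1,\mathcal{X}_2,\mathcal{X}_s$ (inputs of primary transmitters 1, 2 and of the secondary transmitter) and $\mathcal{Y}_p,\mathcal{Y}_s$ (outputs at the primary and secondary receivers) are finite sets, and $\omega(y_py_s|x_1x_2x_s)$ is a conditional probability distribution on $\mathcal{Y}_p\times\mathcal{Y}_s$ given $(x_1,x_2,x_s)\in\mathcal{X}_1\times\mathcal{X}_2\times\mathcal{X}_s$, with marginals $\omega_p(y_p|x_1x_2x_s)$, $\omega_s(y_s|x_1x_2x_s)$. The channel is memoryless: $\omega^n(\mathbf{y}_p\mathbf{y}_s|\mathbf{x}_1\mathbf{x}_2\mathbf{x}_s)=\prod_{t=1}^n\omega(y_p^{(t)}y_s^{(t)}|x_1^{(t)}x_2^{(t)}x_s^{(t)})$, and similarly for $\omega_p^n,\omega_s^n$. Code for $C_{RS}$. A code $(n,M_1,M_2,L_s,N_s,\epsilon)$ for $C_{RS}$ has message sets $\mathcal{M}_a=\{1,\dots,M_a\}$ ($a=1,2$), $\mathcal{L}_s=\{1,\dots,L_s\}$, $\mathcal{N}_s=\{1,\dots,N_s\}$ and consists of: encoders $i\mapsto\mathbf{x}_{ai}\in\mathcal{X}_a^n$, $i\in\mathcal{M}_a$, for $a=1,2$; a secondary encoder $(k,l)\mapsto\mathbf{x}_{skl}\in\mathcal{X}_s^n$ on $\mathcal{L}_s\times\mathcal{N}_s$; disjoint sets $\mathcal{D}_{pijl}\subseteq\mathcal{Y}_p^n$ for $(i,j,l)\in\mathcal{M}_1\times\mathcal{M}_2\times\mathcal{N}_s$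 (the primary receiver decodes $(i,j,l)$ when $\mathbf{y}_p\in\mathcal{D}_{pijl}$); disjoint sets $\mathcal{D}_{skl}\subseteq\mathcal{Y}_s^n$ for $(k,l)\in\mathcal{L}_s\times\mathcal{N}_s$ (the secondary receiver decodes $(k,l)$ when $\mathbf{y}_s\in\mathcal{D}_{skl}$); such that $$\frac{1}{M_1M_2L_sN_s}\sum_{i,j,k,l}\omega_p^n(\mathbf{y}_p\notin\mathcal{D}_{pijl}|\mathbf{x}_{1i}\mathbf{x}_{2j}\mathbf{x}_{skl})\le\epsilon,\qquad \frac{1}{M_1M_2L_sN_s}\sum_{i,j,k,l}\omega_s^n(\mathbf{y}_s\notin\mathcal{D}_{skl}|\mathbf{x}_{1i}\mathbf{x}_{2j}\mathbf{x}_{skl})\le\epsilon.$$ Achievability. A tuple $(R_1,R_2,S,T)$ of nonnegative reals is achievable for $C_{RS}$ if for every $\eta>0$ and $0<\epsilon<1$, for all sufficiently large $n$, there is a code $(n,M_1,M_2,L_s,N_s,\epsilon)$ for $C_{RS}$ with $\frac1n\log M_1\ge R_1-\eta$, $\frac1n\log M_2\ge R_2-\eta$, $\frac1n\log L_s\ge S-\eta$, $\frac1n\log N_s\ge T-\eta$ (logarithms in the same base as the mutual informations). The class $\mathcal{P}^*$. $\mathcal{P}^*$ is the set of all tuples of random variables $Z=QUWX_1X_2X_sY_pY_s$, with $Q,U,W$ taking values in some finite sets and $X_a\in\mathcal{X}_a$, $Y_b\in\mathcal{Y}_b$, such that: $X_1,X_2,U,W$ are conditionally independent given $Q$; $X_s=f(UW|Q)$,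 i.e. $X_s$ is a deterministic function of $(U,W)$ for each value of $Q$; and $(Y_p,Y_s)$ is the channel output for input $(X_1,X_2,X_s)$, i.e. given $(Q,U,W,X_1,X_2,X_s)$ it has conditional law $\omega(\cdot|X_1X_2X_s)$. *)

theory Defs
  imports "HOL-Probability.Probability"
begin

type_synonym ('x1, 'x2, 'xs, 'yp, 'ys) channel =
  "'x1 \<Rightarrow> 'x2 \<Rightarrow> 'xs \<Rightarrow> ('yp \<times> 'ys) pmf"

definition channel_p :: "('x1, 'x2, 'xs, 'yp, 'ys) channel \<Rightarrow> 'x1 \<Rightarrow> 'x2 \<Rightarrow> 'xs \<Rightarrow> 'yp pmf" where
  "channel_p \<omega> x1 x2 xs = map_pmf fst (\<omega> x1 x2 xs)"

definition channel_s :: "('x1, 'x2, 'xs, 'yp, 'ys) channel \<Rightarrow> 'x1 \<Rightarrow> 'x2 \<Rightarrow> 'xs \<Rightarrow> 'ys pmf" where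
  "channel_s \<omega> x1 x2 xs = map_pmf snd (\<omega> x1 x2 xs)"

text \<open>
  A word of length \<open>n\<close> is a function on \<open>{..<n}\<close>, extended by \<open>undefined\<close>; the memoryless
  extension below is therefore supported on \<open>words n\<close>.
\<close>

definition words :: "nat \<Rightarrow> (nat \<Rightarrow> 'x) set" where
  "words n = {..<n} \<rightarrow>\<^sub>E UNIV"

definition memoryless ::
    "nat \<Rightarrow> ('x1 \<Rightarrow> 'x2 \<Rightarrow> 'xs \<Rightarrow> 'y pmf) \<Rightarrow>
     (nat \<Rightarrow> 'x1) \<Rightarrow> (nat \<Rightarrow> 'x2) \<Rightarrow> (nat \<Rightarrow> 'xs) \<Rightarrow> (nat \<Rightarrow> 'y) pmf" where
  "memoryless n V x1 x2 xs = Pi_pmf {..<n} undefined (\<lambda>t. V (x1 t) (x2 t) (xs t))"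

text \<open>
  In a code, \<open>x1\<close>, \<open>x2\<close>, \<open>xs\<close> are the encoders and \<open>Dp i j l\<close>, \<open>Ds k l\<close> the decoding sets.
  The secondary message is a pair \<open>(k, l)\<close>, of which the primary receiver decodes \<open>l\<close> only.
\<close>

definition is_crs_code ::
    "('x1, 'x2, 'xs, 'yp, 'ys) channel \<Rightarrow> nat \<Rightarrow> nat \<Rightarrow> nat \<Rightarrow> nat \<Rightarrow> nat \<Rightarrow> real \<Rightarrow>
     (nat \<Rightarrow> nat \<Rightarrow> 'x1) \<Rightarrow> (nat \<Rightarrow> nat \<Rightarrow> 'x2) \<Rightarrow> (nat \<Rightarrow> nat \<Rightarrow> nat \<Rightarrow> 'xs) \<Rightarrow>
     (nat \<Rightarrow> nat \<Rightarrow> nat \<Rightarrow> (nat \<Rightarrow> 'yp) set) \<Rightarrow> (nat \<Rightarrow> nat \<Rightarrow> (nat \<Rightarrow> 'ys) set) \<Rightarrow> bool" where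
  "is_crs_code \<omega> n M1 M2 Ls Ns \<epsilon> x1 x2 xs Dp Ds \<longleftrightarrow>
     1 \<le> M1 \<and> 1 \<le> M2 \<and> 1 \<le> Ls \<and> 1 \<le> Ns \<and>
     (\<forall>i\<in>{1..M1}. x1 i \<in> words n) \<and>
     (\<forall>j\<in>{1..M2}. x2 j \<in> words n) \<and>
     (\<forall>k\<in>{1..Ls}. \<forall>l\<in>{1..Ns}. xs k l \<in> words n) \<and>
     (\<forall>i\<in>{1..M1}. \<forall>j\<in>{1..M2}. \<forall>l\<in>{1..Ns}. Dp i j l \<subseteq> words n) \<and>
     disjoint_family_on (\<lambda>(i, j, l). Dp i j l) ({1..M1} \<times> {1..M2} \<times> {1..Ns}) \<and>
     (\<forall>k\<in>{1..Ls}. \<forall>l\<in>{1..Ns}. Ds k l \<subseteq> words n) \<and>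
     disjoint_family_on (\<lambda>(k, l). Ds k l) ({1..Ls} \<times> {1..Ns}) \<and>
     (\<Sum>i=1..M1. \<Sum>j=1..M2. \<Sum>k=1..Ls. \<Sum>l=1..Ns.
        measure_pmf.prob (memoryless n (channel_p \<omega>) (x1 i) (x2 j) (xs k l)) (- Dp i j l))
       / (real M1 * real M2 * real Ls * real Ns) \<le> \<epsilon> \<and>
     (\<Sum>i=1..M1. \<Sum>j=1..M2. \<Sum>k=1..Ls. \<Sum>l=1..Ns.
        measure_pmf.prob (memoryless n (channel_s \<omega>) (x1 i) (x2 j) (xs k l)) (- Ds k l))
       / (real M1 * real M2 * real Ls * real Ns) \<le> \<epsilon>"

text \<open>Rates are measured in logarithms to the base \<open>b\<close>.\<close>

definition crs_achievable ::
    "real \<Rightarrow> ('x1, 'x2, 'xs, 'yp, 'ys) channel \<Rightarrow> real \<times> real \<times> real \<times> real \<Rightarrow> bool" where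
  "crs_achievable b \<omega> = (\<lambda>(R1, R2, S, T).
     0 \<le> R1 \<and> 0 \<le> R2 \<and> 0 \<le> S \<and> 0 \<le> T \<and>
     (\<forall>\<eta>>0. \<forall>\<epsilon>. 0 < \<epsilon> \<and> \<epsilon> < 1 \<longrightarrow>
       (\<forall>\<^sub>F n in sequentially.
         \<exists>M1 M2 Ls Ns x1 x2 xs Dp Ds.
           is_crs_code \<omega> n M1 M2 Ls Ns \<epsilon> x1 x2 xs Dp Ds \<and>
           log b (real M1) / real n \<ge> R1 - \<eta> \<and>
           log b (real M2) / real n \<ge> R2 - \<eta> \<and>
           log b (real Ls) / real n \<ge> S - \<eta> \<and>
           log b (real Ns) / real n \<ge> T - \<eta>)))"

text \<open>
  Conditional independence is stated through the conditional joint law on points, which suffices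
  as all variables take finitely many values. Where \<open>Q = q\<close> has probability \<open>0\<close>, both sides of
  that equation are \<open>0\<close>.
\<close>

definition P_star ::
    "'a measure \<Rightarrow> ('x1::finite, 'x2::finite, 'xs::finite, 'yp::finite, 'ys::finite) channel \<Rightarrow>
     (('a \<Rightarrow> 'q::finite) \<times> ('a \<Rightarrow> 'u::finite) \<times> ('a \<Rightarrow> 'w::finite) \<times>
      ('a \<Rightarrow> 'x1) \<times> ('a \<Rightarrow> 'x2) \<times> ('a \<Rightarrow> 'xs) \<times> ('a \<Rightarrow> 'yp) \<times> ('a \<Rightarrow> 'ys)) set" where
  "P_star M \<omega> = {(Q, U, W, X1, X2, Xs, Yp, Ys).
     Q \<in> M \<rightarrow>\<^sub>M count_space UNIV \<and> U \<in> M \<rightarrow>\<^sub>M count_space UNIV \<and> W \<in> M \<rightarrow>\<^sub>M count_space UNIV \<and>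
     X1 \<in> M \<rightarrow>\<^sub>M count_space UNIV \<and> X2 \<in> M \<rightarrow>\<^sub>M count_space UNIV \<and> Xs \<in> M \<rightarrow>\<^sub>M count_space UNIV \<and>
     Yp \<in> M \<rightarrow>\<^sub>M count_space UNIV \<and> Ys \<in> M \<rightarrow>\<^sub>M count_space UNIV \<and>
     (\<forall>q x1 x2 u w.
        \<P>(z in M. X1 z = x1 \<and> X2 z = x2 \<and> U z = u \<and> W z = w \<bar> Q z = q) =
        \<P>(z in M. X1 z = x1 \<bar> Q z = q) * \<P>(z in M. X2 z = x2 \<bar> Q z = q) *
        \<P>(z in M. U z = u \<bar> Q z = q) * \<P>(z in M. W z = w \<bar> Q z = q)) \<and>
     (\<exists>f. AE z in M. Xs z = f (Q z) (U z) (W z)) \<and>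
     (\<forall>q u w x1 x2 xs yp ys.
        \<P>(z in M. Q z = q \<and> U z = u \<and> W z = w \<and> X1 z = x1 \<and> X2 z = x2 \<and> Xs z = xs) > 0 \<longrightarrow>
        \<P>(z in M. Yp z = yp \<and> Ys z = ys \<bar>
            Q z = q \<and> U z = u \<and> W z = w \<and> X1 z = x1 \<and> X2 z = x2 \<and> Xs z = xs) =
        pmf (\<omega> x1 x2 xs) (yp, ys))}"

definition (in information_space) delta_o ::
    "('a \<Rightarrow> 'q) \<times> ('a \<Rightarrow> 'u) \<times> ('a \<Rightarrow> 'w) \<times> ('a \<Rightarrow> 'x1) \<times> ('a \<Rightarrow> 'x2) \<times> ('a \<Rightarrow> 'xs) \<times>
     ('a \<Rightarrow> 'yp) \<times> ('a \<Rightarrow> 'ys) \<Rightarrow> (real \<times> real \<times> real \<times> real) set" where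
  "delta_o = (\<lambda>(Q, U, W, X1, X2, Xs, Yp, Ys). {(R1, R2, S, T).
     0 \<le> R1 \<and> 0 \<le> R2 \<and> 0 \<le> S \<and> 0 \<le> T \<and>
     R1 \<le> \<I>(Yp ; X1 | (\<lambda>z. (W z, X2 z, Q z))) \<and>
     R2 \<le> \<I>(Yp ; X2 | (\<lambda>z. (W z, X1 z, Q z))) \<and>
     T \<le> \<I>(Yp ; W | (\<lambda>z. (X1 z, X2 z, Q z))) \<and>
     R1 + R2 \<le> \<I>(Yp ; (\<lambda>z. (X1 z, X2 z)) | (\<lambda>z. (W z, Q z))) \<and>
     T + R1 \<le> \<I>(Yp ; (\<lambda>z. (W z, X1 z)) | (\<lambda>z. (X2 z, Q z))) \<and>
     T + R2 \<le> \<I>(Yp ; (\<lambda>z. (W z, X2 z)) | (\<lambda>z. (X1 z, Q z))) \<and>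
     T + R1 + R2 \<le> \<I>(Yp ; (\<lambda>z. (W z, X1 z, X2 z)) | Q) \<and>
     S \<le> \<I>(Ys ; U | (\<lambda>z. (W z, Q z))) \<and>
     T \<le> \<I>(Ys ; W | (\<lambda>z. (U z, Q z))) \<and>
     S + T \<le> \<I>(Ys ; (\<lambda>z. (U z, W z)) | Q)})"

end

theory Submission
  imports Defs
begin

text \<open>
  Random coding with a threshold decoder. The four messages belong to four users of a multiple
  access channel, the receivers decoding the users 1, 2, common and private, common respectively;
  the remaining users are averaged out as noise. The codebook is drawn letter by letter (first the
  letter of \<open>Q\<close>, then independent letters for all messages), so that every law involved is the
  \<open>n\<close>-fold power of a single-letter law. A receiver decoding the set \<open>B\<close> of users accepts a message
  if for each nonempty \<open>A \<subseteq> B\<close> the product over time of the ratios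
  \<open>p(y | x\<^sub>B q) / p(y | x\<^bsub>B - A\<^esub> q)\<close> is at least \<open>b powr (n (I - \<delta>))\<close>, where
  \<open>I = I(Y ; X\<^sub>A | X\<^bsub>B - A\<^esub> Q)\<close> is the expected logarithm of the ratio. The true message passes by
  Hoeffding's inequality. For a message that is wrong exactly on \<open>A\<close> the ratio has expectation at most
  \<open>1\<close>, so by Markov's inequality it passes with probability at most \<open>b powr (- n (I - \<delta>))\<close>, and there
  are at most \<open>b powr (n (I - \<eta>))\<close> such messages. Since both receivers fail with small expected
  probability over the same random codebook, some codebook serves both.
\<close>

section \<open>Product distributions\<close>

lemma measure_bind_pmf_eq_expectation:
  "measure_pmf.prob (bind_pmf p f) A = measure_pmf.expectation p (\<lambda>x. measure_pmf.prob (f x) A)"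
proof -
  have "ennreal (measure_pmf.prob (bind_pmf p f) A) = (\<integral>\<^sup>+x. ennreal (measure_pmf.prob (f x) A) \<partial>p)"
    by (simp add: measure_pmf.emeasure_eq_measure [symmetric] del: measure_pmf.emeasure_eq_measure)
  also have "\<dots> = ennreal (measure_pmf.expectation p (\<lambda>x. measure_pmf.prob (f x) A))"
    by (intro nn_integral_eq_integral measure_pmf.integrable_const_bound [where B = 1]) auto
  finally show ?thesis
    by (subst (asm) ennreal_inj) (auto intro: Bochner_Integration.integral_nonneg)
qed

text \<open>A map is a bind into point masses, so \<open>Pi_pmf_bind\<close> also covers maps that
  vary with the coordinate. The guard is needed because \<open>h x\<close> need not send the default
  \<open>d'\<close> to \<open>d\<close>.\<close>

lemma Pi_pmf_map_dependent:
  assumes "finite A"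
  shows "Pi_pmf A d (\<lambda>x. map_pmf (h x) (p x)) =
         map_pmf (\<lambda>f x. if x \<in> A then h x (f x) else d) (Pi_pmf A d' p)"
  using assms by (simp add: map_pmf_def Pi_pmf_bind[where d' = d'])

text \<open>Markov's inequality for the product: by independence its expectation is a product of
  numbers between 0 and 1.\<close>

lemma prob_Pi_pmf_prod_ge:
  fixes r :: "'a \<Rightarrow> real"
  assumes "integrable (measure_pmf p) r" "\<And>x. 0 \<le> r x"
    and "measure_pmf.expectation p r \<le> 1" "0 < \<theta>" "finite I"
  shows "measure_pmf.prob (Pi_pmf I d (\<lambda>_. p)) {z. \<theta> \<le> (\<Prod>t\<in>I. r (z t))} \<le> 1 / \<theta>"
proof -
  have "measure_pmf.prob (Pi_pmf I d (\<lambda>_. p)) {z \<in> space (Pi_pmf I d (\<lambda>_. p)). \<theta> \<le> (\<Prod>t\<in>I. r (z t))}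
      \<le> measure_pmf.expectation (Pi_pmf I d (\<lambda>_. p)) (\<lambda>z. \<Prod>t\<in>I. r (z t)) / \<theta>"
    using assms
    by (intro integral_Markov_inequality_measure[where A = "{}"] integrable_prod_Pi_pmf) (auto intro!: prod_nonneg)
  also have "measure_pmf.expectation (Pi_pmf I d (\<lambda>_. p)) (\<lambda>z. \<Prod>t\<in>I. r (z t))
      = (\<Prod>t\<in>I. measure_pmf.expectation p r)"
    using assms by (intro expectation_prod_Pi_pmf) auto
  also have "\<dots> \<le> 1"
    using assms by (intro prod_le_1) (auto intro: Bochner_Integration.integral_nonneg)
  finally show ?thesis using assms by (simp add: divide_right_mono)
qed

text \<open>The finite support makes the summands bounded, so Hoeffding's inequality gives an
  exponentially small lower tail.\<close>

lemma prob_Pi_pmf_sum_le_tendsto_0: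
  fixes f :: "'a \<Rightarrow> real"
  assumes fin: "finite (set_pmf p)" and \<delta>: "0 < \<delta>"
  shows "(\<lambda>n. measure_pmf.prob (Pi_pmf {..<n} d (\<lambda>_. p))
           {z. (\<Sum>t<n. f (z t)) \<le> real n * (measure_pmf.expectation p f - \<delta>)}) \<longlonglongrightarrow> 0"
proof -
  \<comment> \<open>Inserting 1 keeps \<open>K\<close> positive, so that \<open>K\<close> can be
    divided by in the exponent.\<close>
  define K where "K = Max (insert 1 ((\<lambda>x. \<bar>f x\<bar>) ` set_pmf p))"
  have K: "1 \<le> K" "\<And>x. x \<in> set_pmf p \<Longrightarrow> \<bar>f x\<bar> \<le> K"
    using fin by (auto simp: K_def)
  \<comment> \<open>At \<open>n = 0\<close> the sum of squared ranges in Hoeffding's exponent would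
    be empty.\<close>
  have bound: "measure_pmf.prob (Pi_pmf {..<n} d (\<lambda>_. p))
      {z. (\<Sum>t<n. f (z t)) \<le> real n * (measure_pmf.expectation p f - \<delta>)}
      \<le> exp (- (\<delta>\<^sup>2 / (2 * K\<^sup>2)) * real n)" if "0 < n" for n
  proof -
    let ?P = "Pi_pmf {..<n} d (\<lambda>_. p)"
    have comp: "map_pmf (\<lambda>z. z t) ?P = p" if "t < n" for t
      using that by (simp add: Pi_pmf_component)
    have bd: "\<bar>f (z t)\<bar> \<le> K" if "z \<in> set_pmf ?P" "t < n" for z t
      using that by (intro K) (auto simp: set_Pi_pmf PiE_dflt_def)
    have E: "measure_pmf.expectation ?P (\<lambda>z. f (z t)) = measure_pmf.expectation p f" if "t < n" for t
      using arg_cong[OF comp[OF that], of "\<lambda>p. measure_pmf.expectation p f"] by simp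
    interpret Hoeffding_ineq "measure_pmf ?P" "{..<n}" "\<lambda>t z. f (z t)" "\<lambda>_. - K" "\<lambda>_. K"
      "real n * measure_pmf.expectation p f"
    proof unfold_locales
      show "prob_space.indep_vars ?P (\<lambda>_. borel) (\<lambda>t z. f (z t)) {..<n}"
        by (rule prob_space.indep_vars_compose2[OF measure_pmf.prob_space_axioms indep_vars_Pi_pmf]) auto
      show "AE z in measure_pmf ?P. f (z t) \<in> {- K..K}" if "t \<in> {..<n}" for t
        using bd that by (force intro!: AE_pmfI simp: abs_le_iff)
      show "real n * measure_pmf.expectation p f \<equiv> \<Sum>t<n. measure_pmf.expectation ?P (\<lambda>z. f (z t))"
        by (simp add: E)
    qed simp_all
    have "measure_pmf.prob ?P {z \<in> space (measure_pmf ?P). (\<Sum>t<n. f (z t))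
        \<le> real n * measure_pmf.expectation p f - real n * \<delta>}
      \<le> exp (- 2 * (real n * \<delta>)\<^sup>2 / (\<Sum>t<n. (K - - K)\<^sup>2))"
      using \<delta> K that by (intro Hoeffding_ineq_le) auto
    also have "- 2 * (real n * \<delta>)\<^sup>2 / (\<Sum>t<n. (K - - K)\<^sup>2) = - (\<delta>\<^sup>2 / (2 * K\<^sup>2)) * real n"
      using that K by (simp add: power2_eq_square field_simps)
    finally show ?thesis by (simp add: algebra_simps)
  qed
  have "(\<lambda>n. exp (- (\<delta>\<^sup>2 / (2 * K\<^sup>2)) * real n)) \<longlonglongrightarrow> 0"
  proof -
    have "filterlim (\<lambda>n. (- (\<delta>\<^sup>2 / (2 * K\<^sup>2))) * real n) at_bot sequentially"
      using \<delta> K by (intro filterlim_tendsto_neg_mult_at_bot[OF tendsto_const] filterlim_real_sequentially)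
        auto
    then show ?thesis by (rule filterlim_compose[OF exp_at_bot])
  qed
  then show ?thesis
    by (rule real_tendsto_sandwich[OF _ _ tendsto_const, rotated 2])
       (use bound in \<open>auto intro!: eventually_mono[OF eventually_gt_at_top[of 0]]\<close>)
qed

lemma exists_le_expectation_pmf:
  fixes f :: "'a \<Rightarrow> real"
  assumes "integrable (measure_pmf p) f" "measure_pmf.expectation p f < \<epsilon>"
  shows "\<exists>x\<in>set_pmf p. f x \<le> \<epsilon>"
proof (rule ccontr)
  assume "\<not> ?thesis"
  then have "measure_pmf.expectation p (\<lambda>_. \<epsilon>) \<le> measure_pmf.expectation p f"
    by (intro integral_mono_AE assms AE_pmfI) auto
  with assms show False by simp
qed

lemma measure_eq_measure_pmfI:
  fixes p :: "'x::finite pmf"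
  assumes "prob_space N" "sets N = UNIV" "\<And>x. measure N {x} = pmf p x"
  shows "N = measure_pmf p"
proof -
  interpret prob_space N by fact
  show ?thesis
    by (rule measure_eqI_countable[of _ UNIV])
       (auto simp: assms countable_finite emeasure_eq_measure emeasure_pmf_single)
qed

section \<open>Coupling two codewords and exchanging two independent copies\<close>

text \<open>For one user, \<open>a\<close> and \<open>b\<close> stand for the index sent and the
  index of a rival: equal indices share a letter, distinct ones read independent letters. Both cases
  are images of the same \<open>pair_pmf p p\<close>, so all users can be treated in one
  product.\<close>

lemma map_pmf_eval_pair_iid:
  assumes "finite I" "a \<in> I" "b \<in> I"
  shows "map_pmf (\<lambda>g. (g a, g b)) (Pi_pmf I d (\<lambda>_. p)) =
         map_pmf (\<lambda>(x, x'). (x, if a = b then x else x')) (pair_pmf p p)"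
proof (cases "a = b")
  case True
  have "map_pmf (\<lambda>g. (g a, g b)) (Pi_pmf I d (\<lambda>_. p)) = map_pmf (\<lambda>x. (x, x)) (map_pmf (\<lambda>g. g a) (Pi_pmf I d (\<lambda>_. p)))"
    using True by (simp add: map_pmf_comp)
  also have "\<dots> = map_pmf (\<lambda>x. (x, x)) (map_pmf fst (pair_pmf p p))"
    using assms by (simp add: Pi_pmf_component map_fst_pair_pmf)
  finally show ?thesis using True by (simp add: map_pmf_comp case_prod_unfold)
next
  case False
  \<comment> \<open>Coordinate \<open>a\<close> is split off; it is independent of the rest, which
    still contains \<open>b\<close>.\<close>
  define J where "J = I - {a}"
  have I: "I = insert a J" "finite J" "a \<notin> J" "b \<in> J" using assms False by (auto simp: J_def)
  have "map_pmf (\<lambda>g. (g a, g b)) (Pi_pmf I d (\<lambda>_. p)) =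
    map_pmf (\<lambda>(x, g). (x, g b)) (pair_pmf p (Pi_pmf J d (\<lambda>_. p)))"
    using False I by (simp add: Pi_pmf_insert map_pmf_comp case_prod_unfold)
  also have "\<dots> = pair_pmf (map_pmf id p) (map_pmf (\<lambda>g. g b) (Pi_pmf J d (\<lambda>_. p)))"
    by (subst map_pair [symmetric]) (simp add: case_prod_unfold)
  also have "\<dots> = pair_pmf p p" using I by (simp add: Pi_pmf_component)
  finally show ?thesis using False by (simp add: case_prod_unfold)
qed

lemma pmf_Pi_UNIV:
  fixes p :: "'j::finite \<Rightarrow> 'a pmf"
  shows "pmf (Pi_pmf UNIV d p) x = (\<Prod>j\<in>UNIV. pmf (p j) (x j))"
  by (rule pmf_Pi') auto

text \<open>Unzipping is injective, so the mass at \<open>(x, y)\<close> is read off at its single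
  preimage, where both sides are the same product over \<open>j\<close>.\<close>

lemma pair_pmf_Pi_pmf:
  fixes p :: "'j::finite \<Rightarrow> 'a pmf" and q :: "'j \<Rightarrow> 'b pmf"
  shows "pair_pmf (Pi_pmf UNIV d p) (Pi_pmf UNIV d' q) =
    map_pmf (\<lambda>h. (\<lambda>j. fst (h j), \<lambda>j. snd (h j))) (Pi_pmf UNIV d'' (\<lambda>j. pair_pmf (p j) (q j)))"
proof (rule pmf_eqI, clarify)
  fix x y
  have inj: "inj (\<lambda>h. (\<lambda>j. fst (h j), \<lambda>j. snd (h j)))"
    by (auto simp: inj_on_def fun_eq_iff prod_eq_iff)
  have "pmf (map_pmf (\<lambda>h. (\<lambda>j. fst (h j), \<lambda>j. snd (h j))) (Pi_pmf UNIV d'' (\<lambda>j. pair_pmf (p j) (q j)))) (x, y)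
    = pmf (Pi_pmf UNIV d'' (\<lambda>j. pair_pmf (p j) (q j))) (\<lambda>j. (x j, y j))"
    using pmf_map_inj'[OF inj, of _ "\<lambda>j. (x j, y j)"] by simp
  also have "\<dots> = pmf (pair_pmf (Pi_pmf UNIV d p) (Pi_pmf UNIV d' q)) (x, y)"
    by (simp add: pmf_Pi_UNIV pmf_pair prod.distrib)
  finally show "pmf (pair_pmf (Pi_pmf UNIV d p) (Pi_pmf UNIV d' q)) (x, y) = 
    pmf (map_pmf (\<lambda>h. (\<lambda>j. fst (h j), \<lambda>j. snd (h j))) (Pi_pmf UNIV d'' (\<lambda>j. pair_pmf (p j) (q j)))) (x, y)" ..
qed

text \<open>Swapping \<open>x j\<close> and \<open>x' j\<close> for \<open>j\<close> outside
  \<open>D\<close> keeps each factor of the point mass. This is the change of variables behind both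
  the ratio bound and the formula for \<open>averaged\<close>.\<close>

lemma pair_pmf_Pi_pmf_exchange:
  fixes p :: "'j::finite \<Rightarrow> 'a pmf"
  defines "P \<equiv> Pi_pmf UNIV undefined p"
  shows "map_pmf (\<lambda>(x, x'). (override_on x' x D, override_on x x' D)) (pair_pmf P P) = pair_pmf P P"
proof (rule pmf_eqI, clarify)
  fix x x' :: "'j \<Rightarrow> 'a"
  let ?s = "\<lambda>(x :: 'j \<Rightarrow> 'a, x'). (override_on x' x D, override_on x x' D)"
  have inv: "?s (?s z) = z" for z :: "('j \<Rightarrow> 'a) \<times> ('j \<Rightarrow> 'a)"
    by (cases z) (auto simp: override_on_def fun_eq_iff)
  have "inj ?s" by (rule inj_on_inverseI, rule inv)
  \<comment> \<open>The swap is its own inverse, so the preimage of \<open>(x, x')\<close> is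
    \<open>?s (x, x')\<close>.\<close>
  from pmf_map_inj'[OF this, of "pair_pmf P P" "?s (x, x')"]
  have "pmf (map_pmf ?s (pair_pmf P P)) (x, x') = pmf (pair_pmf P P) (?s (x, x'))"
    by (simp only: inv)
  also have "\<dots> = (\<Prod>j\<in>UNIV. pmf (p j) (override_on x' x D j) * pmf (p j) (override_on x x' D j))"
    by (simp add: pmf_pair P_def pmf_Pi_UNIV prod.distrib)
  also have "\<dots> = (\<Prod>j\<in>UNIV. pmf (p j) (x j) * pmf (p j) (x' j))"
    by (intro prod.cong) (auto simp: override_on_def)
  also have "\<dots> = pmf (pair_pmf P P) (x, x')"
    by (simp add: pmf_pair P_def pmf_Pi_UNIV prod.distrib)
  finally show "pmf (map_pmf ?s (pair_pmf P P)) (x, x') = pmf (pair_pmf P P) (x, x')" .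
qed

lemma expectation_bind_pmf_finite:
  fixes f :: "'c::finite \<Rightarrow> real" and p :: "'d::finite pmf"
  shows "measure_pmf.expectation (bind_pmf p k) f = measure_pmf.expectation p (\<lambda>x. measure_pmf.expectation (k x) f)"
  by (subst (1 2) integral_measure_pmf[of UNIV])
     (auto simp: integral_measure_pmf[of UNIV] pmf_bind sum_distrib_left sum_distrib_right mult_ac intro: sum.swap)

lemma expectation_pmf_finite:
  fixes f :: "'c::finite \<Rightarrow> real"
  shows "measure_pmf.expectation p f = (\<Sum>x\<in>UNIV. pmf p x * f x)"
  by (subst integral_measure_pmf[of UNIV]) auto

section \<open>Single-letter laws of a multiple access channel\<close>

text \<open>One alphabet serves all users, so that a tuple of inputs is a function on users. The
  channel may depend on \<open>q\<close> because it absorbs the secondary encoder's function of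
  \<open>Q\<close>, \<open>U\<close> and \<open>W\<close>.\<close>

locale multiple_access =
  fixes PQ :: "'q::finite pmf" and PX :: "'j::finite \<Rightarrow> 'q \<Rightarrow> 'a::finite pmf"
    and V :: "'q \<Rightarrow> ('j \<Rightarrow> 'a) \<Rightarrow> 'y::finite pmf" and b :: real
  assumes b_gt_1: "1 < b"
begin

definition inputs :: "'q \<Rightarrow> ('j \<Rightarrow> 'a) pmf" where
  "inputs q = Pi_pmf UNIV undefined (\<lambda>j. PX j q)"

text \<open>The channel as seen by a receiver that knows the inputs of the users in \<open>D\<close> only.\<close>

definition averaged :: "'j set \<Rightarrow> 'q \<Rightarrow> ('j \<Rightarrow> 'a) \<Rightarrow> 'y pmf" where
  "averaged D q x = bind_pmf (inputs q) (\<lambda>x'. V q (override_on x' x D))"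

text \<open>Its logarithm is the conditional information density between the inputs in
  \<open>A\<close> and the output, given \<open>q\<close> and the inputs in
  \<open>B - A\<close>.\<close>

definition ratio :: "'j set \<Rightarrow> 'j set \<Rightarrow> 'q \<times> ('j \<Rightarrow> 'a) \<times> 'y \<Rightarrow> real" where
  "ratio B A = (\<lambda>(q, x, y). pmf (averaged B q x) y / pmf (averaged (B - A) q x) y)"

definition joint :: "('q \<times> ('j \<Rightarrow> 'a) \<times> 'y) pmf" where
  "joint = bind_pmf PQ (\<lambda>q. bind_pmf (inputs q) (\<lambda>x. map_pmf (\<lambda>y. (q, x, y)) (V q x)))"

text \<open>
  The law of the output letter together with the input letters of a rival message that differs
  from the one sent exactly for the users in \<open>A\<close>.
\<close>

definition resampled :: "'j set \<Rightarrow> ('q \<times> ('j \<Rightarrow> 'a) \<times> 'y) pmf" where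
  "resampled A = bind_pmf PQ (\<lambda>q. bind_pmf (pair_pmf (inputs q) (inputs q))
     (\<lambda>(x, x'). map_pmf (\<lambda>y. (q, override_on x x' A, y)) (V q x)))"

text \<open>This is I(Y ; X_A | X_{B - A} Q), as
  \<open>conditional_mutual_information_eq_information\<close> shows.\<close>

definition information :: "'j set \<Rightarrow> 'j set \<Rightarrow> real" where
  "information B A = measure_pmf.expectation joint (\<lambda>z. log b (ratio B A z))"

lemma averaged_cong:
  assumes "\<And>j. j \<in> D \<Longrightarrow> x j = x' j"
  shows "averaged D q x = averaged D q x'"
proof -
  have "override_on z x D = override_on z x' D" for z
    using assms by (auto simp: override_on_def)
  then show ?thesis by (simp add: averaged_def)
qed

lemma ratio_cong:
  assumes "\<And>j. j \<in> B \<Longrightarrow> x j = x' j"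
  shows "ratio B A (q, x, y) = ratio B A (q, x', y)"
  using assms averaged_cong[of B x x'] averaged_cong[of "B - A" x x'] by (simp add: ratio_def)

lemma ratio_nonneg: "0 \<le> ratio B A z"
  by (simp add: ratio_def split: prod.split)

text \<open>The tuple \<open>x\<close> itself is among those averaged over, and overriding it by
  itself gives it back, so a letter that \<open>V q x\<close> can produce keeps positive
  mass.\<close>

lemma pmf_averaged_pos:
  assumes "(q, x, y) \<in> set_pmf joint"
  shows "0 < pmf (averaged D q x) y"
proof -
  have *: "x \<in> set_pmf (inputs q)" "y \<in> set_pmf (V q x)" using assms by (auto simp: joint_def)
  then have "y \<in> set_pmf (averaged D q x)"
    by (auto simp: averaged_def override_on_def intro!: bexI[of _ x])
  then show ?thesis by (simp add: pmf_positive)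
qed

lemma ratio_pos: "z \<in> set_pmf joint \<Longrightarrow> 0 < ratio B A z"
  by (cases z) (auto simp: ratio_def intro!: divide_pos_pos pmf_averaged_pos)

text \<open>
  Exchanging \<open>x\<close> and \<open>x'\<close> off \<open>B - A\<close> turns the argument of the ratio into \<open>x\<close> on \<open>B\<close> and the
  output law into the averaged channel in its denominator.
\<close>

lemma expectation_ratio_resampled_le_1:
  assumes "A \<subseteq> B"
  shows "measure_pmf.expectation (resampled A) (ratio B A) \<le> 1"
proof -
  have "measure_pmf.expectation (pair_pmf (inputs q) (inputs q))
          (\<lambda>(x, x'). \<Sum>y\<in>UNIV. pmf (V q x) y * ratio B A (q, override_on x x' A, y)) \<le> 1" for q
  proof -
    let ?D = "B - A"
    have "measure_pmf.expectation (pair_pmf (inputs q) (inputs q))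
          (\<lambda>(x, x'). \<Sum>y\<in>UNIV. pmf (V q x) y * ratio B A (q, override_on x x' A, y))
      = measure_pmf.expectation (map_pmf (\<lambda>(x, x'). (override_on x' x ?D, override_on x x' ?D))
           (pair_pmf (inputs q) (inputs q)))
          (\<lambda>(x, x'). \<Sum>y\<in>UNIV. pmf (V q x) y * ratio B A (q, override_on x x' A, y))"
      by (simp add: inputs_def pair_pmf_Pi_pmf_exchange)
    also have "\<dots> = measure_pmf.expectation (pair_pmf (inputs q) (inputs q))
          (\<lambda>(x, x'). \<Sum>y\<in>UNIV. pmf (V q (override_on x' x ?D)) y *
              ratio B A (q, override_on (override_on x' x ?D) (override_on x x' ?D) A, y))"
      by (simp add: case_prod_unfold)
    also have "\<dots> = measure_pmf.expectation (pair_pmf (inputs q) (inputs q))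
          (\<lambda>(x, x'). \<Sum>y\<in>UNIV. pmf (V q (override_on x' x ?D)) y * ratio B A (q, x, y))"
    proof (intro Bochner_Integration.integral_cong refl, clarify, intro sum.cong refl arg_cong2[of _ _ _ _ "(*)"])
      fix x x' y
      \<comment> \<open>On \<open>A\<close> the argument is read from the second tuple, which is
        \<open>x\<close> off \<open>?D\<close>; on \<open>?D\<close> it is read from the first,
        which is \<open>x\<close> there.\<close>
      show "ratio B A (q, override_on (override_on x' x ?D) (override_on x x' ?D) A, y) = ratio B A (q, x, y)"
        by (rule ratio_cong) (use assms in \<open>auto simp: override_on_def\<close>)
    qed
    also have "\<dots> = measure_pmf.expectation (inputs q) (\<lambda>x. measure_pmf.expectation (inputs q)
          (\<lambda>x'. \<Sum>y\<in>UNIV. pmf (V q (override_on x' x ?D)) y * ratio B A (q, x, y)))"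
      by (simp add: pair_pmf_def expectation_bind_pmf_finite)
    also have "\<dots> = measure_pmf.expectation (inputs q)
        (\<lambda>x. \<Sum>y\<in>UNIV. pmf (averaged ?D q x) y * ratio B A (q, x, y))"
      by (simp add: averaged_def pmf_bind integrable_measure_pmf_finite)
    also have "\<dots> \<le> measure_pmf.expectation (inputs q) (\<lambda>x. 1)"
    proof (intro integral_mono integrable_measure_pmf_finite)
      fix x
      \<comment> \<open>The denominator cancels where it is positive; where it is 0 the term
        vanishes, hence only an inequality.\<close>
      have "(\<Sum>y\<in>UNIV. pmf (averaged ?D q x) y * ratio B A (q, x, y)) \<le> (\<Sum>y\<in>UNIV. pmf (averaged B q x) y)"
        by (intro sum_mono) (simp add: ratio_def)
      also have "\<dots> = 1" by (rule sum_pmf_eq_1) auto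
      finally show "(\<Sum>y\<in>UNIV. pmf (averaged ?D q x) y * ratio B A (q, x, y)) \<le> 1" .
    qed auto
    finally show ?thesis by simp
  qed
  then have "measure_pmf.expectation PQ (\<lambda>q. measure_pmf.expectation (pair_pmf (inputs q) (inputs q))
          (\<lambda>(x, x'). \<Sum>y\<in>UNIV. pmf (V q x) y * ratio B A (q, override_on x x' A, y)))
        \<le> measure_pmf.expectation PQ (\<lambda>q. 1)"
    by (intro integral_mono integrable_measure_pmf_finite) auto
  then show ?thesis
    by (simp add: resampled_def expectation_bind_pmf_finite case_prod_unfold expectation_pmf_finite[of "V _ _"])
qed

end

section \<open>Random codebooks\<close>

context multiple_access
begin

definition letterbook :: "('j \<Rightarrow> nat) \<Rightarrow> ('q \<times> ('j \<Rightarrow> nat \<Rightarrow> 'a)) pmf" where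
  "letterbook M = bind_pmf PQ (\<lambda>q. map_pmf (Pair q)
     (Pi_pmf UNIV undefined (\<lambda>j. Pi_pmf {1..M j} undefined (\<lambda>_. PX j q))))"

definition codebook :: "nat \<Rightarrow> ('j \<Rightarrow> nat) \<Rightarrow> (nat \<Rightarrow> 'q \<times> ('j \<Rightarrow> nat \<Rightarrow> 'a)) pmf" where
  "codebook n M = Pi_pmf {..<n} undefined (\<lambda>_. letterbook M)"

definition select :: "('j \<Rightarrow> nat) \<Rightarrow> ('j \<Rightarrow> nat \<Rightarrow> 'a) \<Rightarrow> 'j \<Rightarrow> 'a" where
  "select m c = (\<lambda>j. c j (m j))"

definition outputs :: "nat \<Rightarrow> (nat \<Rightarrow> 'q \<times> ('j \<Rightarrow> nat \<Rightarrow> 'a)) \<Rightarrow> ('j \<Rightarrow> nat) \<Rightarrow> (nat \<Rightarrow> 'y) pmf" where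
  "outputs n C m = Pi_pmf {..<n} undefined (\<lambda>t. V (fst (C t)) (select m (snd (C t))))"

definition transmission where
  "transmission n M m = bind_pmf (codebook n M) (\<lambda>C. map_pmf (Pair C) (outputs n C m))"

definition typical where
  "typical \<delta> n B C m y \<longleftrightarrow> (\<forall>A. A \<subseteq> B \<and> A \<noteq> {} \<longrightarrow>
     b powr (real n * (information B A - \<delta>)) \<le> (\<Prod>t<n. ratio B A (fst (C t), select m (snd (C t)), y t)))"

text \<open>Rivals are full message tuples, but only those that differ from \<open>m\<close> at a
  decoded user count. Demanding uniqueness makes the sets disjoint.\<close>

definition decoding_set where
  "decoding_set \<delta> n B M C m = {y \<in> words n. typical \<delta> n B C m y \<and>
     (\<forall>m'. (\<forall>j. m' j \<in> {1..M j}) \<and> (\<exists>j\<in>B. m' j \<noteq> m j) \<longrightarrow> \<not> typical \<delta> n B C m' y)}"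

text \<open>The true message is the rival with empty error set, so one family of laws serves both
  halves of the error analysis.\<close>

lemma resampled_empty: "resampled {} = joint"
  by (simp add: resampled_def joint_def pair_pmf_def bind_assoc_pmf bind_return_pmf override_on_def)

text \<open>Users are independent, so \<open>map_pmf_eval_pair_iid\<close> applies user by user:
  where \<open>m\<close> and \<open>m'\<close> agree the letter is shared, elsewhere it is fresh.
  Zipping passes between a pair of tuples and a tuple of pairs.\<close>

lemma map_pmf_select_pair:
  assumes "\<And>j. m j \<in> {1..M j}" "\<And>j. m' j \<in> {1..M j}"
  shows "map_pmf (\<lambda>c. (select m c, select m' c))
           (Pi_pmf UNIV undefined (\<lambda>j. Pi_pmf {1..M j} undefined (\<lambda>_. PX j q))) =
         map_pmf (\<lambda>(x, x'). (x, override_on x x' {j. m j \<noteq> m' j})) (pair_pmf (inputs q) (inputs q))"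
proof -
  let ?unzip = "\<lambda>h :: 'j \<Rightarrow> 'a \<times> 'a. (\<lambda>j. fst (h j), \<lambda>j. snd (h j))"
  have "map_pmf (\<lambda>c. (select m c, select m' c))
           (Pi_pmf UNIV undefined (\<lambda>j. Pi_pmf {1..M j} undefined (\<lambda>_. PX j q))) =
    map_pmf ?unzip (map_pmf (\<lambda>c j. (c j (m j), c j (m' j)))
           (Pi_pmf UNIV undefined (\<lambda>j. Pi_pmf {1..M j} undefined (\<lambda>_. PX j q))))"
    by (simp add: map_pmf_comp select_def)
  also have "map_pmf (\<lambda>c j. (c j (m j), c j (m' j)))
           (Pi_pmf UNIV undefined (\<lambda>j. Pi_pmf {1..M j} undefined (\<lambda>_. PX j q))) =
    Pi_pmf UNIV undefined (\<lambda>j. map_pmf (\<lambda>g. (g (m j), g (m' j))) (Pi_pmf {1..M j} undefined (\<lambda>_. PX j q)))"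
    by (subst Pi_pmf_map_dependent[where d' = undefined]) simp_all
  also have "\<dots> = Pi_pmf UNIV undefined
      (\<lambda>j. map_pmf (\<lambda>(x, x'). (x, if m j = m' j then x else x')) (pair_pmf (PX j q) (PX j q)))"
    by (subst map_pmf_eval_pair_iid) (use assms in simp_all)
  also have "\<dots> = map_pmf (\<lambda>h j. (case h j of (x, x') \<Rightarrow> (x, if m j = m' j then x else x')))
      (Pi_pmf UNIV undefined (\<lambda>j. pair_pmf (PX j q) (PX j q)))"
    by (subst Pi_pmf_map_dependent[where d' = undefined]) simp_all
  also have "map_pmf ?unzip \<dots> = map_pmf (\<lambda>(x, x'). (x, override_on x x' {j. m j \<noteq> m' j}))
      (map_pmf ?unzip (Pi_pmf UNIV undefined (\<lambda>j. pair_pmf (PX j q) (PX j q))))"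
    unfolding map_pmf_comp
    by (intro map_pmf_cong refl) (auto simp: override_on_def fun_eq_iff case_prod_unfold)
  also have "map_pmf ?unzip (Pi_pmf UNIV undefined (\<lambda>j. pair_pmf (PX j q) (PX j q))) = pair_pmf (inputs q) (inputs q)"
    by (simp add: inputs_def pair_pmf_Pi_pmf[where d'' = undefined])
  finally show ?thesis .
qed

text \<open>Only the letters of \<open>m\<close> and \<open>m'\<close> are read from the slot, so
  its law may be replaced by that of the pair in \<open>map_pmf_select_pair\<close>.\<close>

lemma bind_letterbook_eq_resampled:
  assumes "\<And>j. m j \<in> {1..M j}" "\<And>j. m' j \<in> {1..M j}"
  shows "bind_pmf (letterbook M) (\<lambda>(q, c). map_pmf (\<lambda>y. (q, select m' c, y)) (V q (select m c))) =
    resampled {j. m j \<noteq> m' j}"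
proof -
  have "bind_pmf (Pi_pmf UNIV undefined (\<lambda>j. Pi_pmf {1..M j} undefined (\<lambda>_. PX j q)))
        (\<lambda>c. map_pmf (\<lambda>y. (q, select m' c, y)) (V q (select m c))) =
      bind_pmf (pair_pmf (inputs q) (inputs q)) (\<lambda>(x, x').
        map_pmf (\<lambda>y. (q, override_on x x' {j. m j \<noteq> m' j}, y)) (V q x))" for q
    using arg_cong[OF map_pmf_select_pair[OF assms, where q = q],
        of "\<lambda>p. bind_pmf p (\<lambda>(x, x'). map_pmf (\<lambda>y. (q, x', y)) (V q x))"]
    by (simp add: bind_map_pmf case_prod_unfold)
  then show ?thesis
    by (simp add: letterbook_def resampled_def bind_assoc_pmf bind_map_pmf)
qed

text \<open>The slots of the codebook are independent and the channel acts slot by slot, so the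
  single-letter law is lifted to its \<open>n\<close>-fold power.\<close>

lemma map_pmf_transmission:
  assumes "\<And>j. m j \<in> {1..M j}" "\<And>j. m' j \<in> {1..M j}"
  shows "map_pmf (\<lambda>(C, y) t. if t < n then (fst (C t), select m' (snd (C t)), y t) else d) (transmission n M m) =
    Pi_pmf {..<n} d (\<lambda>_. resampled {j. m j \<noteq> m' j})"
proof -
  have "Pi_pmf {..<n} d (\<lambda>_. resampled {j. m j \<noteq> m' j}) =
    bind_pmf (codebook n M) (\<lambda>C. Pi_pmf {..<n} d (\<lambda>t.
      map_pmf (\<lambda>y. (fst (C t), select m' (snd (C t)), y)) (V (fst (C t)) (select m (snd (C t))))))"
    unfolding bind_letterbook_eq_resampled[OF assms, symmetric] codebook_def
    by (subst Pi_pmf_bind[where d' = undefined]) (simp_all add: case_prod_unfold)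
  also have "\<dots> = map_pmf (\<lambda>(C, y) t. if t < n then (fst (C t), select m' (snd (C t)), y t) else d) (transmission n M m)"
    by (subst Pi_pmf_map_dependent[where d' = undefined])
       (simp_all add: transmission_def map_bind_pmf map_pmf_comp outputs_def)
  finally show ?thesis ..
qed

text \<open>The predicate \<open>E\<close> is a lower threshold when a rival is tested and an upper
  one when the true message is.\<close>

lemma prob_transmission_prod_ratio:
  assumes "\<And>j. m j \<in> {1..M j}" "\<And>j. m' j \<in> {1..M j}"
  shows "measure_pmf.prob (transmission n M m)
      {(C, y). E (\<Prod>t<n. ratio B A (fst (C t), select m' (snd (C t)), y t))} =
    measure_pmf.prob (Pi_pmf {..<n} undefined (\<lambda>_. resampled {j. m j \<noteq> m' j})) {z. E (\<Prod>t<n. ratio B A (z t))}"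
  by (subst map_pmf_transmission[OF assms, where n = n and d = undefined, symmetric], unfold measure_map_pmf, intro arg_cong2[where f = measure]) (auto simp: vimage_def case_prod_unfold)

section \<open>Error probability of the threshold decoder\<close>

text \<open>Of all the tests in \<open>typical\<close> only the one for the exact error set
  \<open>A\<close> is kept; under \<open>resampled A\<close> its ratio has expectation at most
  1.\<close>

lemma prob_rival_typical:
  assumes "\<And>j. m j \<in> {1..M j}" "\<And>j. m' j \<in> {1..M j}"
    and A: "A = {j. m j \<noteq> m' j}" "A \<subseteq> B" "A \<noteq> {}"
  shows "measure_pmf.prob (transmission n M m) {(C, y). typical \<delta> n B C m' y}
    \<le> b powr (- (real n * (information B A - \<delta>)))"
proof -
  let ?\<theta> = "b powr (real n * (information B A - \<delta>))"
  have "measure_pmf.prob (transmission n M m) {(C, y). typical \<delta> n B C m' y} \<le>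
    measure_pmf.prob (transmission n M m)
      {(C, y). ?\<theta> \<le> (\<Prod>t<n. ratio B A (fst (C t), select m' (snd (C t)), y t))}"
    using A by (intro measure_pmf.finite_measure_mono) (auto simp: typical_def)
  also have "\<dots> = measure_pmf.prob (Pi_pmf {..<n} undefined (\<lambda>_. resampled A)) {z. ?\<theta> \<le> (\<Prod>t<n. ratio B A (z t))}"
    using prob_transmission_prod_ratio[OF assms(1,2), where E = "\<lambda>x. ?\<theta> \<le> x"] A by simp
  also have "\<dots> \<le> 1 / ?\<theta>"
    using A b_gt_1 by (intro prob_Pi_pmf_prod_ge expectation_ratio_resampled_le_1 integrable_measure_pmf_finite)
      (auto simp: ratio_nonneg)
  finally show ?thesis by (simp add: powr_minus divide_inverse)
qed

text \<open>It involves neither the codebook sizes nor the message, so its limit yields a bound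
  uniform in both.\<close>

definition atypicality where
  "atypicality \<delta> B A n = measure_pmf.prob (Pi_pmf {..<n} undefined (\<lambda>_. joint))
     {z. (\<Sum>t<n. log b (ratio B A (z t))) \<le> real n * (information B A - \<delta>)}"

lemma atypicality_tendsto_0: "0 < \<delta> \<Longrightarrow> atypicality \<delta> B A \<longlonglongrightarrow> 0"
  unfolding atypicality_def information_def by (rule prob_Pi_pmf_sum_le_tendsto_0) auto

text \<open>Union bound over the tests; for the true message each one observes independent samples
  of \<open>joint\<close>.\<close>

lemma prob_not_typical:
  assumes "\<And>j. m j \<in> {1..M j}"
  shows "measure_pmf.prob (transmission n M m) {(C, y). \<not> typical \<delta> n B C m y}
    \<le> (\<Sum>A | A \<subseteq> B \<and> A \<noteq> {}. atypicality \<delta> B A n)"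
proof -
  let ?\<theta> = "\<lambda>A. b powr (real n * (information B A - \<delta>))"
  let ?r = "\<lambda>A C y. (\<Prod>t<n. ratio B A (fst (C t), select m (snd (C t)), y t))"
  have "measure_pmf.prob (transmission n M m) {(C, y). \<not> typical \<delta> n B C m y}
    \<le> measure_pmf.prob (transmission n M m) (\<Union>A \<in> {A. A \<subseteq> B \<and> A \<noteq> {}}. {(C, y). ?r A C y < ?\<theta> A})"
    by (intro measure_pmf.finite_measure_mono) (auto simp: typical_def not_le)
  also have "\<dots> \<le> (\<Sum>A | A \<subseteq> B \<and> A \<noteq> {}. measure_pmf.prob (transmission n M m) {(C, y). ?r A C y < ?\<theta> A})"
    by (intro measure_pmf.finite_measure_subadditive_finite) auto
  also have "\<dots> \<le> (\<Sum>A | A \<subseteq> B \<and> A \<noteq> {}. atypicality \<delta> B A n)"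
  proof (intro sum_mono)
    fix A
    have "measure_pmf.prob (transmission n M m) {(C, y). ?r A C y < ?\<theta> A} =
      measure_pmf.prob (Pi_pmf {..<n} undefined (\<lambda>_. joint)) {z. (\<Prod>t<n. ratio B A (z t)) < ?\<theta> A}"
      using prob_transmission_prod_ratio[OF assms assms, where E = "\<lambda>x. x < ?\<theta> A"] by (simp add: resampled_empty)
    also have "\<dots> \<le> atypicality \<delta> B A n"
      unfolding atypicality_def
    \<comment> \<open>The inclusion is claimed only on the support, where all ratios are positive
      and the logarithm of the product splits.\<close>
    proof (intro measure_pmf.finite_measure_mono_AE AE_pmfI impI)
      fix z assume "z \<in> set_pmf (Pi_pmf {..<n} undefined (\<lambda>_. joint))"
        and *: "z \<in> {z. (\<Prod>t<n. ratio B A (z t)) < ?\<theta> A}"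
      then have pos: "0 < ratio B A (z t)" if "t < n" for t
        using that by (intro ratio_pos) (auto simp: set_Pi_pmf PiE_dflt_def)
      then have "(\<Sum>t<n. log b (ratio B A (z t))) = log b (\<Prod>t<n. ratio B A (z t))"
        by (simp add: log_def sum_divide_distrib [symmetric]) (subst ln_prod; force)
      also have "\<dots> \<le> log b (?\<theta> A)"
        using * b_gt_1 pos by (intro log_mono prod_pos) auto
      finally show "z \<in> {z. (\<Sum>t<n. log b (ratio B A (z t))) \<le> real n * (information B A - \<delta>)}"
        using b_gt_1 by simp
    qed simp
    finally show "measure_pmf.prob (transmission n M m) {(C, y). ?r A C y < ?\<theta> A} \<le> atypicality \<delta> B A n" .
  qed
  finally show ?thesis .
qed

lemma typical_cong:
  assumes "\<And>j. j \<in> B \<Longrightarrow> m j = m' j"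
  shows "typical \<delta> n B C m y = typical \<delta> n B C m' y"
proof -
  have "ratio B A (q, select m c, y) = ratio B A (q, select m' c, y)" for A q c y
    by (rule ratio_cong) (simp add: select_def assms)
  then show ?thesis by (simp add: typical_def)
qed

text \<open>Lets the final code index a receiver's sets by the decoded messages alone.\<close>

lemma decoding_set_cong:
  assumes "\<And>j. j \<in> B \<Longrightarrow> m j = m' j"
  shows "decoding_set \<delta> n B M C m = decoding_set \<delta> n B M C m'"
  using assms typical_cong[OF assms] by (simp add: decoding_set_def cong: bex_cong)

text \<open>For a word in both sets, the second makes \<open>m'\<close> typical while the first
  forbids this for a rival of \<open>m\<close>.\<close>

lemma decoding_set_disjoint:
  assumes "\<And>j. m j \<in> {1..M j}" "\<And>j. m' j \<in> {1..M j}" "\<exists>j\<in>B. m j \<noteq> m' j"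
  shows "decoding_set \<delta> n B M C m \<inter> decoding_set \<delta> n B M C m' = {}"
  using assms unfolding decoding_set_def by blast

text \<open>A rival is determined by its values on \<open>A\<close>, where each must avoid
  \<open>m j\<close>. The exact factor \<open>M j - 1\<close> matters: the sizes will be ceilings,
  and a ceiling minus 1 stays below the number rounded up.\<close>

lemma card_rivals:
  fixes M m :: "'j \<Rightarrow> nat"
  assumes "\<And>j. m j \<in> {1..M j}"
  shows "card {m'. (\<forall>j. m' j \<in> {1..M j}) \<and> {j. m j \<noteq> m' j} = A} \<le> (\<Prod>j\<in>A. M j - 1)"
proof -
  let ?R = "{m'. (\<forall>j. m' j \<in> {1..M j}) \<and> {j. m j \<noteq> m' j} = A}"
  have "inj_on (\<lambda>m'. restrict m' A) ?R"
  proof (rule inj_onI)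
    fix f g assume f: "f \<in> ?R" and g: "g \<in> ?R" and eq: "restrict f A = restrict g A"
    show "f = g"
    proof
      fix j
      show "f j = g j"
        using f g fun_cong[OF eq, of j] by (cases "j \<in> A") auto
    qed
  qed
  then have "card ?R = card ((\<lambda>m'. restrict m' A) ` ?R)" by (rule card_image [symmetric])
  also have "\<dots> \<le> card (Pi\<^sub>E A (\<lambda>j. {1..M j} - {m j}))"
    by (intro card_mono finite_PiE) auto
  also have "\<dots> = (\<Prod>j\<in>A. M j - 1)"
    using assms by (subst card_PiE) (auto intro!: prod.cong)
  finally show ?thesis .
qed

text \<open>Decoding fails only if the true message is atypical or some rival is typical; the rivals
  are grouped by their error set.\<close>

lemma prob_not_decoded:
  assumes "\<And>j. m j \<in> {1..M j}"
  shows "measure_pmf.prob (transmission n M m) {(C, y). y \<notin> decoding_set \<delta> n B M C m} \<le>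
    (\<Sum>A | A \<subseteq> B \<and> A \<noteq> {}. atypicality \<delta> B A n +
      real (\<Prod>j\<in>A. M j - 1) * b powr (- (real n * (information B A - \<delta>))))"
proof -
  let ?P = "measure_pmf.prob (transmission n M m)"
  let ?S = "{A. A \<subseteq> B \<and> A \<noteq> {}}"
  let ?R = "\<lambda>A. {m'. (\<forall>j. m' j \<in> {1..M j}) \<and> {j. m j \<noteq> m' j} = A}"
  have fin: "finite (?R A)" for A
    by (rule finite_subset[of _ "Pi\<^sub>E UNIV (\<lambda>j. {1..M j})"]) (auto intro: finite_PiE)
  have "?P {(C, y). y \<notin> decoding_set \<delta> n B M C m} \<le>
    ?P ({(C, y). \<not> typical \<delta> n B C m y} \<union> (\<Union>A\<in>?S. \<Union>m'\<in>?R A. {(C, y). typical \<delta> n B C m' y}))"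
  proof (intro measure_pmf.finite_measure_mono_AE AE_pmfI impI)
    fix z assume z: "z \<in> set_pmf (transmission n M m)" "z \<in> {(C, y). y \<notin> decoding_set \<delta> n B M C m}"
    obtain C y where [simp]: "z = (C, y)" by (cases z)
    \<comment> \<open>Membership in \<open>words n\<close>, part of \<open>decoding_set\<close>, is
      guaranteed only on the support of the output law.\<close>
    have "y \<in> words n"
      using z(1) by (auto simp: transmission_def outputs_def set_Pi_pmf PiE_dflt_def words_def PiE_def extensional_def)
    show "z \<in> {(C, y). \<not> typical \<delta> n B C m y} \<union> (\<Union>A\<in>?S. \<Union>m'\<in>?R A. {(C, y). typical \<delta> n B C m' y})"
    proof (cases "typical \<delta> n B C m y")
      case True
      with z(2) \<open>y \<in> words n\<close> obtain m' where
        m': "\<forall>j. m' j \<in> {1..M j}" "\<exists>j\<in>B. m' j \<noteq> m j" "typical \<delta> n B C m' y"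
        by (auto simp: decoding_set_def)
      \<comment> \<open>Resetting \<open>m'\<close> to \<open>m\<close> outside \<open>B\<close>
        changes no test and brings the error set inside \<open>B\<close>.\<close>
      define m'' where "m'' = override_on m m' B"
      have "typical \<delta> n B C m'' y"
        using m'(3) typical_cong[of B m' m''] by (simp add: m''_def override_on_def)
      moreover have "m'' \<in> ?R {j. m j \<noteq> m'' j}"
        using m'(1) assms by (auto simp: m''_def override_on_def)
      moreover have "{j. m j \<noteq> m'' j} \<in> ?S"
        using m'(2) by (auto simp: m''_def override_on_def split: if_splits) metis
      ultimately show ?thesis by auto
    qed auto
  qed simp
  also have "\<dots> \<le> ?P {(C, y). \<not> typical \<delta> n B C m y} +
      ?P (\<Union>A\<in>?S. \<Union>m'\<in>?R A. {(C, y). typical \<delta> n B C m' y})"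
    by (rule measure_Un_le) auto
  also have "?P (\<Union>A\<in>?S. \<Union>m'\<in>?R A. {(C, y). typical \<delta> n B C m' y}) \<le>
      (\<Sum>A\<in>?S. ?P (\<Union>m'\<in>?R A. {(C, y). typical \<delta> n B C m' y}))"
    by (rule measure_pmf.finite_measure_subadditive_finite) auto
  also have "\<dots> \<le> (\<Sum>A\<in>?S. real (\<Prod>j\<in>A. M j - 1) * b powr (- (real n * (information B A - \<delta>))))"
  proof (intro sum_mono)
    fix A assume A: "A \<in> ?S"
    have "?P (\<Union>m'\<in>?R A. {(C, y). typical \<delta> n B C m' y}) \<le>
        (\<Sum>m'\<in>?R A. ?P {(C, y). typical \<delta> n B C m' y})"
      by (intro measure_pmf.finite_measure_subadditive_finite fin) auto
    also have "\<dots> \<le> (\<Sum>m'\<in>?R A. b powr (- (real n * (information B A - \<delta>))))"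
      using A assms by (intro sum_mono prob_rival_typical) auto
    also have "\<dots> = real (card (?R A)) * b powr (- (real n * (information B A - \<delta>)))" by simp
    also have "\<dots> \<le> real (\<Prod>j\<in>A. M j - 1) * b powr (- (real n * (information B A - \<delta>)))"
      using card_rivals[OF assms, where A = A] by (intro mult_right_mono of_nat_mono) auto
    finally show "?P (\<Union>m'\<in>?R A. {(C, y). typical \<delta> n B C m' y}) \<le>
      real (\<Prod>j\<in>A. M j - 1) * b powr (- (real n * (information B A - \<delta>)))" .
  qed
  finally show ?thesis
    using prob_not_typical[where m = m and M = M and n = n and \<delta> = \<delta> and B = B] assms
    by (simp add: sum.distrib)
qed

text \<open>The rates give up \<open>\<eta>\<close> and the threshold only
  \<open>\<eta> / 2\<close>, so each error set contributes a rival term of at most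
  \<open>b powr (- (\<eta> / 2) * real n)\<close>. The bound \<open>e\<close> is chosen before the
  codebook sizes and the message, hence is uniform in them.\<close>

theorem random_coding:
  assumes rates: "\<And>A. A \<subseteq> B \<Longrightarrow> A \<noteq> {} \<Longrightarrow> (\<Sum>j\<in>A. \<rho> j) \<le> information B A"
    and \<eta>: "0 < \<eta>"
  obtains e where "e \<longlonglongrightarrow> 0"
    and "\<And>n M m. (\<And>j. real (M j - 1) \<le> b powr (real n * (\<rho> j - \<eta>))) \<Longrightarrow> (\<And>j. m j \<in> {1..M j}) \<Longrightarrow>
      measure_pmf.expectation (codebook n M)
        (\<lambda>C. measure_pmf.prob (outputs n C m) (- decoding_set (\<eta> / 2) n B M C m)) \<le> e n"
proof
  let ?S = "{A. A \<subseteq> B \<and> A \<noteq> {}}"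
  let ?e = "\<lambda>n. \<Sum>A\<in>?S. atypicality (\<eta> / 2) B A n + b powr (- (\<eta> / 2) * real n)"
  have "(\<lambda>n. exp (- (\<eta> / 2) * ln b * real n)) \<longlonglongrightarrow> 0"
    using \<eta> b_gt_1 by (intro filterlim_compose[OF exp_at_bot]
      filterlim_tendsto_neg_mult_at_bot[OF tendsto_const] filterlim_real_sequentially) (auto intro: mult_pos_pos)
  then have "(\<lambda>n. b powr (- (\<eta> / 2) * real n)) \<longlonglongrightarrow> 0"
    using b_gt_1 by (simp add: powr_def mult_ac)
  then have "?e \<longlonglongrightarrow> (\<Sum>A\<in>?S. 0 + 0)"
    using \<eta> by (intro tendsto_sum tendsto_add atypicality_tendsto_0) auto
  then show "?e \<longlonglongrightarrow> 0" by simp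
  fix n and M m :: "'j \<Rightarrow> nat"
  assume M: "\<And>j. real (M j - 1) \<le> b powr (real n * (\<rho> j - \<eta>))" and m: "\<And>j. m j \<in> {1..M j}"
  let ?D = "\<lambda>C. decoding_set (\<eta> / 2) n B M C m"
  have "measure_pmf.expectation (codebook n M) (\<lambda>C. measure_pmf.prob (outputs n C m) (- ?D C)) =
    measure_pmf.prob (transmission n M m) {(C, y). y \<notin> ?D C}"
    unfolding transmission_def measure_bind_pmf_eq_expectation measure_map_pmf
    by (intro Bochner_Integration.integral_cong arg_cong2[where f = measure]) auto
  also have "\<dots> \<le> (\<Sum>A\<in>?S. atypicality (\<eta> / 2) B A n +
      real (\<Prod>j\<in>A. M j - 1) * b powr (- (real n * (information B A - \<eta> / 2))))"
    by (rule prob_not_decoded[OF m])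
  also have "\<dots> \<le> ?e n"
  proof (intro sum_mono add_left_mono)
    fix A assume A: "A \<in> ?S"
    have "real (\<Prod>j\<in>A. M j - 1) \<le> (\<Prod>j\<in>A. b powr (real n * (\<rho> j - \<eta>)))"
      using M by (simp only: of_nat_prod) (intro prod_mono, simp)
    also have "\<dots> = b powr (\<Sum>j\<in>A. real n * (\<rho> j - \<eta>))"
      using b_gt_1 by (simp add: powr_sum)
    also have "(\<Sum>j\<in>A. real n * (\<rho> j - \<eta>)) = real n * ((\<Sum>j\<in>A. \<rho> j) - real (card A) * \<eta>)"
      by (simp add: sum_subtractf flip: sum_distrib_left)
    finally have *: "real (\<Prod>j\<in>A. M j - 1) \<le> b powr (real n * ((\<Sum>j\<in>A. \<rho> j) - real (card A) * \<eta>))" .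
    \<comment> \<open>Each user in \<open>A\<close> gives up \<open>\<eta>\<close>, so a nonempty
      \<open>A\<close> gives up at least \<open>\<eta>\<close> in total.\<close>
    have "1 \<le> real (card A)" using A by (simp add: Suc_le_eq card_gt_0_iff)
    then have "1 * \<eta> \<le> real (card A) * \<eta>" using \<eta> by (intro mult_right_mono) auto
    with rates[of A] A have "(\<Sum>j\<in>A. \<rho> j) - real (card A) * \<eta> \<le> information B A - \<eta>" by auto
    then have "real n * ((\<Sum>j\<in>A. \<rho> j) - real (card A) * \<eta>) \<le> real n * (information B A - \<eta>)"
      by (intro mult_left_mono) auto
    with * have "real (\<Prod>j\<in>A. M j - 1) \<le> b powr (real n * (information B A - \<eta>))"
      using b_gt_1 by (meson order_trans powr_mono less_imp_le)
    then have "real (\<Prod>j\<in>A. M j - 1) * b powr (- (real n * (information B A - \<eta> / 2))) \<le>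
      b powr (real n * (information B A - \<eta>)) * b powr (- (real n * (information B A - \<eta> / 2)))"
      by (rule mult_right_mono) simp
    also have "\<dots> = b powr (- (\<eta> / 2) * real n)"
      unfolding powr_add [symmetric] by (simp add: algebra_simps)
    finally show "real (\<Prod>j\<in>A. M j - 1) * b powr (- (real n * (information B A - \<eta> / 2)))
      \<le> b powr (- (\<eta> / 2) * real n)" .
  qed
  finally show "measure_pmf.expectation (codebook n M)
      (\<lambda>C. measure_pmf.prob (outputs n C m) (- ?D C)) \<le> ?e n" .
qed

end

section \<open>Conditional mutual information\<close>

lemma (in prob_space) simple_function_finite:
  fixes X :: "'a \<Rightarrow> 'x::finite"
  assumes "X \<in> M \<rightarrow>\<^sub>M count_space UNIV"
  shows "simple_function M X"
  using measurable_sets[OF assms] by (auto simp: simple_function_def intro: finite_subset[OF subset_UNIV])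

lemma (in prob_space) expectation_finite_valued:
  fixes T :: "'a \<Rightarrow> 't::finite" and h :: "'t \<Rightarrow> real"
  assumes "T \<in> M \<rightarrow>\<^sub>M count_space UNIV"
  shows "expectation (\<lambda>z. h (T z)) = (\<Sum>t\<in>UNIV. h t * prob (T -` {t} \<inter> space M))"
proof -
  have sets: "T -` {t} \<inter> space M \<in> sets M" for t
    using measurable_sets[OF assms] by simp
  have "expectation (\<lambda>z. h (T z)) = expectation (\<lambda>z. \<Sum>t\<in>UNIV. h t * indicator (T -` {t} \<inter> space M) z)"
  proof (rule Bochner_Integration.integral_cong)
    fix z assume "z \<in> space M"
    then have "(\<Sum>t\<in>UNIV. h t * indicator (T -` {t} \<inter> space M) z) = (\<Sum>t\<in>{T z}. h t)"
      by (intro sum.mono_neutral_cong_right) auto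
    then show "h (T z) = (\<Sum>t\<in>UNIV. h t * indicator (T -` {t} \<inter> space M) z)" by simp
  qed simp
  also have "\<dots> = (\<Sum>t\<in>UNIV. expectation (\<lambda>z. h t * indicator (T -` {t} \<inter> space M) z))"
    using sets by (intro Bochner_Integration.integral_sum integrable_mult_right) (auto simp: emeasure_eq_measure)
  also have "\<dots> = (\<Sum>t\<in>UNIV. h t * prob (T -` {t} \<inter> space M))"
    using sets by simp
  finally show ?thesis .
qed

text \<open>
  Written this way, the conditional mutual information visibly depends only on the partitions
  induced by the random variables and not on how their values are encoded.
\<close>

lemma (in information_space) conditional_mutual_information_eq_expectation:
  fixes X :: "'a \<Rightarrow> 'x::finite" and Y :: "'a \<Rightarrow> 'y::finite" and Z :: "'a \<Rightarrow> 'z::finite"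
  assumes X: "X \<in> M \<rightarrow>\<^sub>M count_space UNIV" and Y: "Y \<in> M \<rightarrow>\<^sub>M count_space UNIV"
    and Z: "Z \<in> M \<rightarrow>\<^sub>M count_space UNIV"
  shows "\<I>(X ; Y | Z) = expectation (\<lambda>z. log b
    (prob {z' \<in> space M. X z' = X z \<and> Y z' = Y z \<and> Z z' = Z z} /
     (prob {z' \<in> space M. X z' = X z \<and> Z z' = Z z} *
      (prob {z' \<in> space M. Y z' = Y z \<and> Z z' = Z z} / prob {z' \<in> space M. Z z' = Z z}))))"
proof -
  let ?T = "\<lambda>z. (X z, Y z, Z z)"
  let ?P = "\<lambda>F t. prob (F -` {t} \<inter> space M)"
  let ?h = "\<lambda>(x, y, z). log b (?P ?T (x, y, z) / (?P (\<lambda>z. (X z, Z z)) (x, z) * (?P (\<lambda>z. (Y z, Z z)) (y, z) / ?P Z z)))"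
  note sf = simple_function_finite[OF X] simple_function_finite[OF Y] simple_function_finite[OF Z]
  have T: "?T \<in> M \<rightarrow>\<^sub>M count_space UNIV"
    using X Y Z by measurable
  have "\<I>(X ; Y | Z) = (\<Sum>(x, y, z)\<in>?T ` space M. ?P ?T (x, y, z) *
      log b (?P ?T (x, y, z) / (?P (\<lambda>z. (X z, Z z)) (x, z) * (?P (\<lambda>z. (Y z, Z z)) (y, z) / ?P Z z))))"
    by (rule conditional_mutual_information_eq;
        rule simple_distributedI[OF _ _ refl]) (auto intro!: simple_function_Pair sf)
  also have "\<dots> = (\<Sum>t\<in>UNIV. ?h t * ?P ?T t)"
  proof (intro sum.mono_neutral_cong_left ballI)
    fix t assume "t \<in> UNIV - ?T ` space M"
    then have "?T -` {t} \<inter> space M = {}" by auto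
    then show "?h t * ?P ?T t = 0" by simp
  qed (auto simp: mult_ac)
  also have "\<dots> = expectation (\<lambda>z. ?h (?T z))"
    by (rule expectation_finite_valued[OF T, symmetric])
  also have "\<dots> = expectation (\<lambda>z. log b
    (prob {z' \<in> space M. X z' = X z \<and> Y z' = Y z \<and> Z z' = Z z} /
     (prob {z' \<in> space M. X z' = X z \<and> Z z' = Z z} *
      (prob {z' \<in> space M. Y z' = Y z \<and> Z z' = Z z} / prob {z' \<in> space M. Z z' = Z z}))))"
    by (simp add: vimage_def Int_def conj_commute)
  finally show ?thesis .
qed

section \<open>Averaged channels as conditional probabilities\<close>

context multiple_access
begin

text \<open>Pairing \<open>x\<close> with a fresh copy and exchanging them off \<open>D\<close> separates the event from the output.\<close>

lemma prob_joint_eq_averaged: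
  "measure_pmf.prob joint {(q', x', y'). q' = q \<and> (\<forall>j\<in>D. x' j = x j) \<and> y' = y} =
   pmf PQ q * measure_pmf.prob (inputs q) {x'. \<forall>j\<in>D. x' j = x j} * pmf (averaged D q x) y"
proof -
  let ?E = "{x'. \<forall>j\<in>D. x' j = x j}"
  let ?I = "\<lambda>x'. indicator ?E x' :: real"
  have "measure_pmf.prob joint {(q', x', y'). q' = q \<and> (\<forall>j\<in>D. x' j = x j) \<and> y' = y} =
    measure_pmf.expectation PQ (\<lambda>q'. indicator {q} q' *
      measure_pmf.expectation (inputs q) (\<lambda>x'. ?I x' * pmf (V q x') y))"
  proof -
    have "measure_pmf.prob (V q x') {y'. (\<forall>j\<in>D. x' j = x j) \<and> y' = y} = ?I x' * pmf (V q x') y" for x'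
    proof (cases "x' \<in> ?E")
      case True
      then have "{y'. (\<forall>j\<in>D. x' j = x j) \<and> y' = y} = {y}" by blast
      then show ?thesis using True by (simp only: measure_pmf_single indicator_simps mult_1)
    next
      case False
      then have *: "{y'. (\<forall>j\<in>D. x' j = x j) \<and> y' = y} = {}" by blast
      show ?thesis unfolding * using False by auto
    qed
    then have "measure_pmf.expectation (inputs q') (\<lambda>x'. measure_pmf.prob (V q' x')
        {y'. q' = q \<and> (\<forall>j\<in>D. x' j = x j) \<and> y' = y}) =
      indicator {q} q' * measure_pmf.expectation (inputs q) (\<lambda>x'. ?I x' * pmf (V q x') y)" for q'
      by (cases "q' = q") simp_all
    then show ?thesis
      unfolding joint_def measure_bind_pmf_eq_expectation measure_map_pmf by (simp only: vimage_Collect_eq prod.case)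
  qed
  also have "\<dots> = pmf PQ q * measure_pmf.expectation (inputs q) (\<lambda>x'. ?I x' * pmf (V q x') y)"
    by (simp add: measure_pmf_single)
  also have "measure_pmf.expectation (inputs q) (\<lambda>x'. ?I x' * pmf (V q x') y) =
    measure_pmf.expectation (map_pmf (\<lambda>(x, x'). (override_on x' x D, override_on x x' D)) (pair_pmf (inputs q) (inputs q)))
      (\<lambda>(x', x''). ?I x' * pmf (V q x') y)"
    by (simp add: inputs_def pair_pmf_Pi_pmf_exchange)
       (simp add: pair_pmf_def expectation_bind_pmf_finite)
  also have "\<dots> = measure_pmf.expectation (pair_pmf (inputs q) (inputs q))
      (\<lambda>(x', x''). ?I x' * pmf (V q (override_on x'' x D)) y)"
  proof -
    have "?I (override_on x'' x' D) * pmf (V q (override_on x'' x' D)) y = ?I x' * pmf (V q (override_on x'' x D)) y"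
      for x' x''
    proof (cases "x' \<in> ?E")
      case True
      then have "override_on x'' x' D = override_on x'' x D" by (auto simp: override_on_def)
      with True show ?thesis by (auto simp: indicator_def)
    qed (auto simp: indicator_def)
    then show ?thesis by (simp add: case_prod_unfold)
  qed
  also have "\<dots> = measure_pmf.expectation (inputs q) (\<lambda>x'. ?I x' *
      measure_pmf.expectation (inputs q) (\<lambda>x''. pmf (V q (override_on x'' x D)) y))"
    by (simp add: pair_pmf_def expectation_bind_pmf_finite)
  also have "\<dots> = measure_pmf.prob (inputs q) ?E * pmf (averaged D q x) y"
    by (simp add: averaged_def pmf_bind)
  finally show ?thesis by simp
qed

text \<open>Sum of \<open>prob_joint_eq_averaged\<close> over the output letters, the averaged
  channel having total mass 1.\<close>

lemma prob_joint_eq_inputs: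
  "measure_pmf.prob joint {(q', x', y'). q' = q \<and> (\<forall>j\<in>D. x' j = x j)} =
   pmf PQ q * measure_pmf.prob (inputs q) {x'. \<forall>j\<in>D. x' j = x j}"
proof -
  have "measure_pmf.prob joint {(q', x', y'). q' = q \<and> (\<forall>j\<in>D. x' j = x j)} =
    measure_pmf.prob joint (\<Union>y. {(q', x', y'). q' = q \<and> (\<forall>j\<in>D. x' j = x j) \<and> y' = y})"
    by (intro arg_cong2[where f = measure]) auto
  also have "\<dots> = (\<Sum>y\<in>UNIV. measure_pmf.prob joint {(q', x', y'). q' = q \<and> (\<forall>j\<in>D. x' j = x j) \<and> y' = y})"
    by (intro measure_pmf.finite_measure_finite_Union) (auto simp: disjoint_family_on_def)
  also have "\<dots> = pmf PQ q * measure_pmf.prob (inputs q) {x'. \<forall>j\<in>D. x' j = x j} * (\<Sum>y\<in>UNIV. pmf (averaged D q x) y)"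
    by (simp only: prob_joint_eq_averaged sum_distrib_left)
  also have "(\<Sum>y\<in>UNIV. pmf (averaged D q x) y) = 1" by (rule sum_pmf_eq_1) auto
  finally show ?thesis by simp
qed

text \<open>Quotient of the two preceding formulas: \<open>averaged\<close> is the conditional law
  of the output given \<open>q\<close> and the inputs in \<open>D\<close>. On the support the
  cancelled factors are nonzero.\<close>

lemma pmf_averaged_eq_ratio:
  assumes "(q, x, y) \<in> set_pmf joint"
  shows "pmf (averaged D q x) y =
    measure_pmf.prob joint {(q', x', y'). q' = q \<and> (\<forall>j\<in>D. x' j = x j) \<and> y' = y} /
    measure_pmf.prob joint {(q', x', y'). q' = q \<and> (\<forall>j\<in>D. x' j = x j)}"
proof -
  have "0 < measure_pmf.prob joint {(q, x, y)}" using assms by (simp add: measure_pmf_single pmf_positive)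
  also have "\<dots> \<le> measure_pmf.prob joint {(q', x', y'). q' = q \<and> (\<forall>j\<in>D. x' j = x j)}"
    by (intro measure_pmf.finite_measure_mono) auto
  finally have "pmf PQ q \<noteq> 0" "measure_pmf.prob (inputs q) {x'. \<forall>j\<in>D. x' j = x j} \<noteq> 0"
    unfolding prob_joint_eq_inputs by auto
  then show ?thesis unfolding prob_joint_eq_averaged prob_joint_eq_inputs by simp
qed

end

text \<open>Mutual information depends only on partitions, and \<open>XZ\<close> and
  \<open>Z'\<close> say that the partitions of \<open>(X, Z)\<close> and \<open>Z\<close> are those
  of \<open>Q\<close> with the letters in \<open>B\<close> and in \<open>B - A\<close>. The order
  and packaging of the variables is thereby immaterial.\<close>

lemma (in information_space) conditional_mutual_information_eq_information:
  fixes Q :: "'a \<Rightarrow> 'q::finite" and L :: "'a \<Rightarrow> 'j::finite \<Rightarrow> 'l::finite" and Y :: "'a \<Rightarrow> 'y::finite"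
    and X :: "'a \<Rightarrow> 'x::finite" and Z :: "'a \<Rightarrow> 'z::finite"
  assumes X: "X \<in> M \<rightarrow>\<^sub>M count_space UNIV" and Y: "Y \<in> M \<rightarrow>\<^sub>M count_space UNIV"
    and Z: "Z \<in> M \<rightarrow>\<^sub>M count_space UNIV"
    and G: "(\<lambda>z. (Q z, L z, Y z)) \<in> M \<rightarrow>\<^sub>M count_space UNIV"
    and law: "distr M (count_space UNIV) (\<lambda>z. (Q z, L z, Y z)) = measure_pmf (multiple_access.joint PQ PX V)"
    and XZ: "\<And>z z'. X z = X z' \<and> Z z = Z z' \<longleftrightarrow> Q z = Q z' \<and> (\<forall>j\<in>B. L z j = L z' j)"
    and Z': "\<And>z z'. Z z = Z z' \<longleftrightarrow> Q z = Q z' \<and> (\<forall>j\<in>B - A. L z j = L z' j)"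
  shows "\<I>(Y ; X | Z) = multiple_access.information PQ PX V b B A"
proof -
  interpret multiple_access PQ PX V b using b_gt_1 by unfold_locales
  let ?G = "\<lambda>z. (Q z, L z, Y z)"
  have prob_joint: "measure_pmf.prob joint S = prob {z \<in> space M. ?G z \<in> S}" for S
    unfolding law [symmetric] by (subst measure_distr[OF G]) (auto simp: vimage_def Int_def conj_commute)
  have "information B A = expectation (\<lambda>z. log b (ratio B A (?G z)))"
    unfolding information_def law [symmetric] by (rule integral_distr[OF G]) auto
  also have "\<dots> = \<I>(Y ; X | Z)"
    unfolding conditional_mutual_information_eq_expectation[OF Y X Z]
  proof (rule integral_cong_AE)
    have "AE g in joint. g \<in> set_pmf joint" by (rule AE_measure_pmf)
    then have "AE z in M. ?G z \<in> set_pmf joint"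
      unfolding law [symmetric] by (subst (asm) AE_distr_iff[OF G]) auto
    then show "AE z in M. log b (ratio B A (?G z)) = log b
      (prob {z' \<in> space M. Y z' = Y z \<and> X z' = X z \<and> Z z' = Z z} /
       (prob {z' \<in> space M. Y z' = Y z \<and> Z z' = Z z} *
        (prob {z' \<in> space M. X z' = X z \<and> Z z' = Z z} / prob {z' \<in> space M. Z z' = Z z})))"
    proof eventually_elim
      case (elim z)
      have 1: "prob {z' \<in> space M. Y z' = Y z \<and> X z' = X z \<and> Z z' = Z z} =
          measure_pmf.prob joint {(q', x', y'). q' = Q z \<and> (\<forall>j\<in>B. x' j = L z j) \<and> y' = Y z}"
        unfolding prob_joint using XZ[of _ z] by (auto intro!: arg_cong[where f = prob])
      have 2: "prob {z' \<in> space M. X z' = X z \<and> Z z' = Z z} =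
          measure_pmf.prob joint {(q', x', y'). q' = Q z \<and> (\<forall>j\<in>B. x' j = L z j)}"
        unfolding prob_joint using XZ[of _ z] by (auto intro!: arg_cong[where f = prob])
      have 3: "prob {z' \<in> space M. Y z' = Y z \<and> Z z' = Z z} =
          measure_pmf.prob joint {(q', x', y'). q' = Q z \<and> (\<forall>j\<in>B - A. x' j = L z j) \<and> y' = Y z}"
        unfolding prob_joint using Z'[of _ z] by (auto intro!: arg_cong[where f = prob])
      have 4: "prob {z' \<in> space M. Z z' = Z z} =
          measure_pmf.prob joint {(q', x', y'). q' = Q z \<and> (\<forall>j\<in>B - A. x' j = L z j)}"
        unfolding prob_joint using Z'[of _ z] by (auto intro!: arg_cong[where f = prob])
      \<comment> \<open>Each averaged channel in \<open>ratio\<close> is a quotient of two of the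
        four probabilities; rearranging gives the integrand.\<close>
      show ?case
        unfolding 1 2 3 4 using pmf_averaged_eq_ratio[OF elim] by (simp add: ratio_def field_simps)
    qed
    show "(\<lambda>z. log b (ratio B A (?G z))) \<in> borel_measurable M"
      by (rule measurable_compose[OF G]) simp
    let ?T = "\<lambda>z. (X z, Y z, Z z)"
    have T: "?T \<in> M \<rightarrow>\<^sub>M count_space UNIV" using X Y Z by measurable
    show "(\<lambda>z. log b
      (prob {z' \<in> space M. Y z' = Y z \<and> X z' = X z \<and> Z z' = Z z} /
       (prob {z' \<in> space M. Y z' = Y z \<and> Z z' = Z z} *
        (prob {z' \<in> space M. X z' = X z \<and> Z z' = Z z} / prob {z' \<in> space M. Z z' = Z z})))) \<in> borel_measurable M"
      using measurable_compose[OF T, of "\<lambda>(x, y, z). log b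
        (prob {z' \<in> space M. Y z' = y \<and> X z' = x \<and> Z z' = z} /
         (prob {z' \<in> space M. Y z' = y \<and> Z z' = z} *
          (prob {z' \<in> space M. X z' = x \<and> Z z' = z} / prob {z' \<in> space M. Z z' = z})))" borel]
      by simp
  qed
  finally show ?thesis ..
qed

section \<open>Letters of the rate-splitting channel\<close>

text \<open>A pmf must have positive mass at almost every point; here the points of mass 0 form a
  finite union of null sets.\<close>

lemma (in prob_space) exists_pmf_eq_distr:
  fixes X :: "'a \<Rightarrow> 'x::finite"
  assumes "X \<in> M \<rightarrow>\<^sub>M count_space UNIV"
  shows "\<exists>p. distr M (count_space UNIV) X = measure_pmf p"
proof -
  let ?D = "distr M (count_space UNIV) X"
  interpret D: prob_space ?D using assms by (rule prob_space_distr)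
  have "(\<Union>x\<in>{x. measure ?D {x} = 0}. {x}) \<in> null_sets ?D"
    by (rule null_sets_UN') (auto simp: null_sets_def D.emeasure_eq_measure countable_finite)
  then have "AE x in ?D. measure ?D {x} \<noteq> 0"
    by (rule AE_I') auto
  then have "measure_pmf (Abs_pmf ?D) = ?D"
    by (intro Abs_pmf_inverse) (auto intro: D.prob_space_axioms)
  then show ?thesis by metis
qed

text \<open>The multiplied form covers null values of \<open>Q\<close>, where any pmf will do; for
  the others the kernel is the law of \<open>X\<close> under the measure conditioned on
  \<open>Q z = q\<close>.\<close>

lemma (in prob_space) exists_conditional_pmf:
  fixes Q :: "'a \<Rightarrow> 'q::finite" and X :: "'a \<Rightarrow> 'x::finite"
  assumes Q: "Q \<in> M \<rightarrow>\<^sub>M count_space UNIV" and X: "X \<in> M \<rightarrow>\<^sub>M count_space UNIV"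
  shows "\<exists>K. \<forall>q x. prob {z \<in> space M. Q z = q \<and> X z = x} = prob {z \<in> space M. Q z = q} * pmf (K q) x"
proof -
  have "\<exists>p. \<forall>x. prob {z \<in> space M. Q z = q \<and> X z = x} = prob {z \<in> space M. Q z = q} * pmf p x" for q
  proof -
    let ?A = "{z \<in> space M. Q z = q}"
    have A: "?A \<in> sets M" using Q by measurable
    have le: "prob {z \<in> space M. Q z = q \<and> X z = x} \<le> prob ?A" for x
      using A by (intro finite_measure_mono) auto
    show ?thesis
    proof (cases "prob ?A = 0")
      case True
      then show ?thesis using le by (auto intro!: antisym)
    next
      case False
      let ?U = "uniform_measure M ?A"
      interpret U: prob_space ?U
        using False by (intro prob_space_uniform_measure) (auto simp: emeasure_eq_measure)
      obtain p where p: "distr ?U (count_space UNIV) X = measure_pmf p"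
        using U.exists_pmf_eq_distr[of X] X by (auto simp: measurable_def)
      have "pmf p x = prob {z \<in> space M. Q z = q \<and> X z = x} / prob ?A" for x
      proof -
        have S: "X -` {x} \<inter> space M \<in> sets M" using X by (rule measurable_sets) simp
        have "pmf p x = measure ?U (X -` {x} \<inter> space M)"
          unfolding measure_pmf_single [symmetric] p [symmetric] using X by (subst measure_distr) auto
        also have "\<dots> = prob (?A \<inter> (X -` {x} \<inter> space M)) / prob ?A"
          using False S A by (intro measure_uniform_measure) (auto simp: emeasure_eq_measure)
        also have "?A \<inter> (X -` {x} \<inter> space M) = {z \<in> space M. Q z = q \<and> X z = x}" by auto
        finally show ?thesis .
      qed
      then show ?thesis using False by (intro exI[of _ p]) simp
    qed
  qed
  then show ?thesis by (intro choice allI)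
qed

text \<open>The case \<open>D = UNIV\<close> of \<open>prob_joint_eq_averaged\<close>, in which no
  user is averaged out.\<close>

lemma (in multiple_access) pmf_joint:
  "pmf joint (q, x, y) = pmf PQ q * (\<Prod>j\<in>UNIV. pmf (PX j q) (x j)) * pmf (V q x) y"
proof -
  have 1: "{(q', x', y'). q' = q \<and> (\<forall>j\<in>UNIV. x' j = x j) \<and> y' = y} = {(q, x, y)}"
    by (auto simp: fun_eq_iff)
  have 2: "{x'. \<forall>j\<in>UNIV. x' j = x j} = {x}"
    by (auto simp: fun_eq_iff)
  have "averaged UNIV q x = V q x"
    by (simp add: averaged_def override_on_def)
  then show ?thesis
    using prob_joint_eq_averaged[of q UNIV x y] unfolding 1 2 measure_pmf_single
    by (simp add: inputs_def pmf_Pi_UNIV)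
qed

lemma map_pmf_joint:
  fixes b :: real
  assumes "1 < b"
  shows "map_pmf (\<lambda>(q, x, y). (q, x, h y)) (multiple_access.joint PQ PX V) =
    multiple_access.joint PQ PX (\<lambda>q x. map_pmf h (V q x))"
proof -
  have "multiple_access b" using assms by unfold_locales
  then show ?thesis
    by (simp add: multiple_access.joint_def map_bind_pmf map_pmf_comp)
qed

section \<open>The four users and their letters\<close>

text \<open>\<open>Private\<close> sends the index \<open>k\<close> with letters of
  \<open>U\<close>, and \<open>Common\<close> the index \<open>l\<close> with letters of
  \<open>W\<close>.\<close>

datatype user = First | Second | Private | Common

lemma UNIV_user: "UNIV = {First, Second, Private, Common}"
  by (auto intro: user.exhaust)

instance user :: finite
  by standard (simp add: UNIV_user)

lemma all_user: "(\<forall>j. P j) \<longleftrightarrow> P First \<and> P Second \<and> P Private \<and> P Common"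
  by (metis user.exhaust)

text \<open>The four alphabets are merged into a sum to fit the single alphabet of
  \<open>multiple_access\<close>.\<close>

type_synonym ('x1, 'x2, 'u, 'w) letters = "user \<Rightarrow> 'x1 + 'x2 + 'u + 'w"

definition encode :: "'x1 \<Rightarrow> 'x2 \<Rightarrow> 'u \<Rightarrow> 'w \<Rightarrow> ('x1, 'x2, 'u, 'w) letters" where
  "encode x1 x2 u w = case_user (Inl x1) (Inr (Inl x2)) (Inr (Inr (Inl u))) (Inr (Inr (Inr w)))"

text \<open>On letters outside the range of \<open>encode\<close>, which have probability \<open>0\<close>, the value is arbitrary.\<close>

definition decode :: "('x1 \<Rightarrow> 'x2 \<Rightarrow> 'u \<Rightarrow> 'w \<Rightarrow> 'c) \<Rightarrow> ('x1, 'x2, 'u, 'w) letters \<Rightarrow> 'c" where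
  "decode F x = F (projl (x First)) (projl (projr (x Second)))
     (projl (projr (projr (x Private)))) (projr (projr (projr (x Common))))"

lemma encode_simps [simp]:
  "encode x1 x2 u w First = Inl x1" "encode x1 x2 u w Second = Inr (Inl x2)"
  "encode x1 x2 u w Private = Inr (Inr (Inl u))" "encode x1 x2 u w Common = Inr (Inr (Inr w))"
  by (simp_all add: encode_def)

lemma decode_encode [simp]: "decode F (encode x1 x2 u w) = F x1 x2 u w"
  by (simp add: decode_def)

lemma encode_inject: "encode x1 x2 u w = encode x1' x2' u' w' \<longleftrightarrow> x1 = x1' \<and> x2 = x2' \<and> u = u' \<and> w = w'"
  by (auto simp: fun_eq_iff all_user)

text \<open>Compared on points: conditional independence yields the product of the input laws, and
  the channel condition the last factor.\<close>

lemma (in prob_space) P_star_law: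
  fixes b :: real
  assumes Z: "(Q, U, W, X1, X2, Xs, Yp, Ys) \<in> P_star M \<omega>" and b: "1 < b"
  obtains PQ PX f where
    "distr M (count_space UNIV) (\<lambda>z. (Q z, encode (X1 z) (X2 z) (U z) (W z), (Yp z, Ys z))) =
      measure_pmf (multiple_access.joint PQ PX (\<lambda>q. decode (\<lambda>x1 x2 u w. \<omega> x1 x2 (f q u w))))"
proof -
  define L where "L = (\<lambda>z. encode (X1 z) (X2 z) (U z) (W z))"
  have [measurable]: "Q \<in> M \<rightarrow>\<^sub>M count_space UNIV" "U \<in> M \<rightarrow>\<^sub>M count_space UNIV" "W \<in> M \<rightarrow>\<^sub>M count_space UNIV"
     "X1 \<in> M \<rightarrow>\<^sub>M count_space UNIV" "X2 \<in> M \<rightarrow>\<^sub>M count_space UNIV" "Xs \<in> M \<rightarrow>\<^sub>M count_space UNIV"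
     "Yp \<in> M \<rightarrow>\<^sub>M count_space UNIV" "Ys \<in> M \<rightarrow>\<^sub>M count_space UNIV"
    using Z by (simp_all add: P_star_def)
  have indep: "\<P>(z in M. X1 z = x1 \<and> X2 z = x2 \<and> U z = u \<and> W z = w \<bar> Q z = q) =
        \<P>(z in M. X1 z = x1 \<bar> Q z = q) * \<P>(z in M. X2 z = x2 \<bar> Q z = q) *
        \<P>(z in M. U z = u \<bar> Q z = q) * \<P>(z in M. W z = w \<bar> Q z = q)" for q x1 x2 u w
    using Z unfolding P_star_def by blast
  obtain f where f: "AE z in M. Xs z = f (Q z) (U z) (W z)"
    using Z by (auto simp: P_star_def)
  have chan: "\<P>(z in M. Yp z = yp \<and> Ys z = ys \<bar>
            Q z = q \<and> U z = u \<and> W z = w \<and> X1 z = x1 \<and> X2 z = x2 \<and> Xs z = xs) =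
        pmf (\<omega> x1 x2 xs) (yp, ys)"
    if "0 < \<P>(z in M. Q z = q \<and> U z = u \<and> W z = w \<and> X1 z = x1 \<and> X2 z = x2 \<and> Xs z = xs)"
    for q u w x1 x2 xs yp ys
    using Z that unfolding P_star_def by blast
  have L: "L \<in> M \<rightarrow>\<^sub>M count_space UNIV"
    using measurable_compose[of "\<lambda>z. (X1 z, X2 z, U z, W z)" M "count_space UNIV" "\<lambda>(x1, x2, u, w). encode x1 x2 u w"]
    by (simp add: L_def)
  have Lj: "(\<lambda>z. L z j) \<in> M \<rightarrow>\<^sub>M count_space UNIV" for j
    using measurable_compose[OF L, of "\<lambda>x. x j"] by simp
  obtain PQ where PQ: "distr M (count_space UNIV) Q = measure_pmf PQ"
    using exists_pmf_eq_distr[of Q] by auto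
  have pmf_PQ: "pmf PQ q = prob {z \<in> space M. Q z = q}" for q
    unfolding measure_pmf_single [symmetric] PQ [symmetric]
    by (subst measure_distr) (auto simp: vimage_def Int_def conj_commute)
  have "\<forall>j. \<exists>K. \<forall>q a. prob {z \<in> space M. Q z = q \<and> L z j = a} = pmf PQ q * pmf (K q) a"
    unfolding pmf_PQ by (intro allI exists_conditional_pmf Lj) simp
  from choice[OF this] obtain PX
    where PX: "\<And>j q a. prob {z \<in> space M. Q z = q \<and> L z j = a} = pmf PQ q * pmf (PX j q) a"
    by blast
  have cond: "\<P>(z in M. P z \<bar> Q z = q) = prob {z \<in> space M. Q z = q \<and> P z} / pmf PQ q" for P q
    unfolding cond_prob_def pmf_PQ by (simp add: conj_commute)
  have inputs: "prob {z \<in> space M. Q z = q \<and> L z = x} = pmf PQ q * (\<Prod>j\<in>UNIV. pmf (PX j q) (x j))" for q x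
  \<comment> \<open>If \<open>q\<close> is null or some letter of \<open>x\<close> is never taken,
    for instance because it lies in the wrong summand, both sides are 0.\<close>
  proof (cases "pmf PQ q = 0 \<or> (\<exists>j. \<forall>z. L z j \<noteq> x j)")
    case True
    then have "prob {z \<in> space M. Q z = q \<and> L z = x} = 0"
    proof
      assume "pmf PQ q = 0"
      moreover have "prob {z \<in> space M. Q z = q \<and> L z = x} \<le> pmf PQ q"
        unfolding pmf_PQ by (intro finite_measure_mono) auto
      ultimately show ?thesis by (simp add: antisym)
    next
      assume "\<exists>j. \<forall>z. L z j \<noteq> x j"
      then have "{z \<in> space M. Q z = q \<and> L z = x} = {}" by auto
      then show ?thesis by (simp only: measure_empty)
    qed
    moreover have "pmf PQ q = 0 \<or> (\<exists>j. pmf (PX j q) (x j) = 0)"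
      using True
    proof
      assume "\<exists>j. \<forall>z. L z j \<noteq> x j"
      then obtain j where "{z \<in> space M. Q z = q \<and> L z j = x j} = {}" by auto
      with PX[of q j "x j"] have "pmf PQ q * pmf (PX j q) (x j) = 0" by (simp only: measure_empty)
      then show ?thesis by auto
    qed simp
    ultimately show ?thesis by auto
  next
    case False
    then have "pmf PQ q \<noteq> 0" and "\<forall>j. \<exists>z. L z j = x j" by auto
    \<comment> \<open>The sample points \<open>g j\<close> may differ between users; from each only
      the letter of user \<open>j\<close> is read.\<close>
    from choice[OF this(2)] obtain g where g: "\<And>j. L (g j) j = x j" by blast
    define x1 where "x1 = X1 (g First)"
    define x2 where "x2 = X2 (g Second)"
    define u where "u = U (g Private)"
    define w where "w = W (g Common)"
    have x: "x = encode x1 x2 u w"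
    proof
      show "x j = encode x1 x2 u w j" for j
        using g[of j] by (cases j) (simp_all add: L_def x1_def x2_def u_def w_def)
    qed
    have "prob {z \<in> space M. Q z = q \<and> L z = x} =
        prob {z \<in> space M. Q z = q \<and> X1 z = x1 \<and> X2 z = x2 \<and> U z = u \<and> W z = w}"
      by (simp add: x L_def encode_inject)
    also have "\<dots> = pmf PQ q * (prob {z \<in> space M. Q z = q \<and> X1 z = x1 \<and> X2 z = x2 \<and> U z = u \<and> W z = w} / pmf PQ q)"
      using \<open>pmf PQ q \<noteq> 0\<close> by simp
    also have "\<dots> = pmf PQ q * (prob {z \<in> space M. Q z = q \<and> X1 z = x1} / pmf PQ q *
        (prob {z \<in> space M. Q z = q \<and> X2 z = x2} / pmf PQ q) *
        (prob {z \<in> space M. Q z = q \<and> U z = u} / pmf PQ q) *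
        (prob {z \<in> space M. Q z = q \<and> W z = w} / pmf PQ q))"
      using indep[of x1 x2 u w q] unfolding cond by (simp only:)
    also have "\<dots> = pmf PQ q * (\<Prod>j\<in>UNIV. pmf (PX j q) (x j))"
    proof -
      have "prob {z \<in> space M. Q z = q \<and> L z j = a} / pmf PQ q = pmf (PX j q) a" for j a
        using \<open>pmf PQ q \<noteq> 0\<close> by (simp add: PX)
      from this[of First "x First"] this[of Second "x Second"] this[of Private "x Private"] this[of Common "x Common"]
      have "prob {z \<in> space M. Q z = q \<and> X1 z = x1} / pmf PQ q = pmf (PX First q) (x First)"
        "prob {z \<in> space M. Q z = q \<and> X2 z = x2} / pmf PQ q = pmf (PX Second q) (x Second)"
        "prob {z \<in> space M. Q z = q \<and> U z = u} / pmf PQ q = pmf (PX Private q) (x Private)"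
        "prob {z \<in> space M. Q z = q \<and> W z = w} / pmf PQ q = pmf (PX Common q) (x Common)"
        by (simp_all add: x L_def)
      then show ?thesis by (simp only: UNIV_user) simp
    qed
    finally show ?thesis .
  qed
  interpret multiple_access PQ PX "\<lambda>q. decode (\<lambda>x1 x2 u w. \<omega> x1 x2 (f q u w))" b
    using b by unfold_locales
  have G: "(\<lambda>z. (Q z, L z, (Yp z, Ys z))) \<in> M \<rightarrow>\<^sub>M count_space UNIV"
    using L by simp
  have "distr M (count_space UNIV) (\<lambda>z. (Q z, L z, (Yp z, Ys z))) = measure_pmf joint"
  proof (rule measure_eq_measure_pmfI)
    fix g :: "'b \<times> ('e, 'f, 'c, 'd) letters \<times> 'h \<times> 'i"
    obtain q x yp ys where g: "g = (q, x, yp, ys)" by (cases g)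
    have "measure (distr M (count_space UNIV) (\<lambda>z. (Q z, L z, (Yp z, Ys z)))) {g} =
        prob {z \<in> space M. Q z = q \<and> L z = x \<and> Yp z = yp \<and> Ys z = ys}"
      by (subst measure_distr[OF G]) (auto simp: g intro!: arg_cong[where f = prob])
    also have "\<dots> = prob {z \<in> space M. Q z = q \<and> L z = x} *
        pmf (decode (\<lambda>x1 x2 u w. \<omega> x1 x2 (f q u w)) x) (yp, ys)"
    proof (cases "\<exists>x1 x2 u w. x = encode x1 x2 u w")
      case False
      then have "{z \<in> space M. Q z = q \<and> L z = x \<and> Yp z = yp \<and> Ys z = ys} = {}"
        "{z \<in> space M. Q z = q \<and> L z = x} = {}" by (auto simp: L_def)
      then show ?thesis by (simp only: measure_empty)
    next
      case True
      then obtain x1 x2 u w where x: "x = encode x1 x2 u w" by auto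
      let ?xs = "f q u w"
      let ?E = "\<lambda>z. Q z = q \<and> U z = u \<and> W z = w \<and> X1 z = x1 \<and> X2 z = x2 \<and> Xs z = ?xs"
      \<comment> \<open>Since \<open>Xs\<close> equals \<open>f\<close> of the other variables
        almost surely, adding \<open>Xs z = ?xs\<close> to the event keeps its probability and
        matches the conditioning in \<open>chan\<close>.\<close>
      have 1: "prob {z \<in> space M. Q z = q \<and> L z = x \<and> Yp z = yp \<and> Ys z = ys} =
          prob {z \<in> space M. (Yp z = yp \<and> Ys z = ys) \<and> ?E z}"
        unfolding x L_def encode_inject using f by (intro finite_measure_eq_AE) auto
      have 2: "prob {z \<in> space M. Q z = q \<and> L z = x} = prob {z \<in> space M. ?E z}"
        unfolding x L_def encode_inject using f by (intro finite_measure_eq_AE) auto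
      have le: "prob {z \<in> space M. (Yp z = yp \<and> Ys z = ys) \<and> ?E z} \<le> prob {z \<in> space M. ?E z}"
        by (intro finite_measure_mono) auto
      show ?thesis
      proof (cases "prob {z \<in> space M. ?E z} = 0")
        case True
        then show ?thesis using le unfolding 1 2 by (simp add: antisym)
      next
        case False
        then have "0 < prob {z \<in> space M. ?E z}" by (simp add: zero_less_measure_iff)
        from chan[OF this, of yp ys] show ?thesis
          using False unfolding 1 2 cond_prob_def by (simp add: x field_simps)
      qed
    qed
    also have "\<dots> = pmf joint g" by (simp add: g pmf_joint inputs)
    finally show "measure (distr M (count_space UNIV) (\<lambda>z. (Q z, L z, (Yp z, Ys z)))) {g} = pmf joint g" .
  qed (simp_all add: prob_space_distr[OF G])
  then show ?thesis by (intro that) (simp add: L_def)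
qed

section \<open>The coding theorem\<close>

definition message :: "nat \<Rightarrow> nat \<Rightarrow> nat \<Rightarrow> nat \<Rightarrow> user \<Rightarrow> nat" where
  "message i j k l = case_user i j k l"

lemma message_simps [simp]:
  "message i j k l First = i" "message i j k l Second = j"
  "message i j k l Private = k" "message i j k l Common = l"
  by (simp_all add: message_def)

text \<open>The seven possible error sets, one for each inequality at the primary receiver.\<close>

lemma subset_primary:
  assumes "A \<subseteq> {First, Second, Common}" "A \<noteq> {}"
  shows "A \<in> {{First}, {Second}, {Common}, {First, Second}, {Common, First}, {Common, Second}, {Common, First, Second}}"
proof -
  have "A \<in> Pow {First, Second, Common}" using assms by simp
  then show ?thesis using assms(2) by (simp add: Pow_insert insert_commute)
qed

lemma subset_secondary:
  assumes "A \<subseteq> {Private, Common}" "A \<noteq> {}"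
  shows "A \<in> {{Private}, {Common}, {Private, Common}}"
proof -
  have "A \<in> Pow {Private, Common}" using assms by simp
  then show ?thesis using assms(2) by (simp add: Pow_insert insert_commute)
qed

text \<open>Each inequality of \<open>delta_o\<close> that involves \<open>Yp\<close> is the rate
  condition of one error set; the letters of \<open>U\<close> are averaged out.\<close>

lemma (in information_space) primary_rates:
  assumes meas: "Q \<in> M \<rightarrow>\<^sub>M count_space UNIV" "U \<in> M \<rightarrow>\<^sub>M count_space UNIV" "W \<in> M \<rightarrow>\<^sub>M count_space UNIV"
     "X1 \<in> M \<rightarrow>\<^sub>M count_space UNIV" "X2 \<in> M \<rightarrow>\<^sub>M count_space UNIV" "Yp \<in> M \<rightarrow>\<^sub>M count_space UNIV"
    and law: "distr M (count_space UNIV) (\<lambda>z. (Q z, encode (X1 z) (X2 z) (U z) (W z), Yp z)) =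
      measure_pmf (multiple_access.joint PQ PX V)"
    and Z: "(R1, R2, S, T) \<in> delta_o (Q, U, W, X1, X2, Xs, Yp, Ys)"
    and A: "A \<subseteq> {First, Second, Common}" "A \<noteq> {}"
  shows "(\<Sum>j\<in>A. case_user R1 R2 S T j) \<le> multiple_access.information PQ PX V b {First, Second, Common} A"
proof -
  let ?B = "{First, Second, Common}"
  have G: "(\<lambda>z. (Q z, encode (X1 z) (X2 z) (U z) (W z), Yp z)) \<in> M \<rightarrow>\<^sub>M count_space UNIV"
    using measurable_compose[of "\<lambda>z. (Q z, X1 z, X2 z, U z, W z, Yp z)" M "count_space UNIV"
        "\<lambda>(q, x1, x2, u, w, y). (q, encode x1 x2 u w, y)" "count_space UNIV"] meas
    by simp
  note eq = conditional_mutual_information_eq_information[where B = ?B, OF _ meas(6) _ G law]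
  have 1: "\<I>(Yp ; X1 | (\<lambda>z. (W z, X2 z, Q z))) = multiple_access.information PQ PX V b ?B {First}"
    using meas by (intro eq) (auto simp: insert_Diff_if)
  have 2: "\<I>(Yp ; X2 | (\<lambda>z. (W z, X1 z, Q z))) = multiple_access.information PQ PX V b ?B {Second}"
    using meas by (intro eq) (auto simp: insert_Diff_if)
  have 3: "\<I>(Yp ; W | (\<lambda>z. (X1 z, X2 z, Q z))) = multiple_access.information PQ PX V b ?B {Common}"
    using meas by (intro eq) (auto simp: insert_Diff_if)
  have 4: "\<I>(Yp ; (\<lambda>z. (X1 z, X2 z)) | (\<lambda>z. (W z, Q z))) = multiple_access.information PQ PX V b ?B {First, Second}"
    using meas by (intro eq) (auto simp: insert_Diff_if)
  have 5: "\<I>(Yp ; (\<lambda>z. (W z, X1 z)) | (\<lambda>z. (X2 z, Q z))) = multiple_access.information PQ PX V b ?B {Common, First}"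
    using meas by (intro eq) (auto simp: insert_Diff_if)
  have 6: "\<I>(Yp ; (\<lambda>z. (W z, X2 z)) | (\<lambda>z. (X1 z, Q z))) = multiple_access.information PQ PX V b ?B {Common, Second}"
    using meas by (intro eq) (auto simp: insert_Diff_if)
  have 7: "\<I>(Yp ; (\<lambda>z. (W z, X1 z, X2 z)) | Q) = multiple_access.information PQ PX V b ?B {Common, First, Second}"
    using meas by (intro eq) (auto simp: insert_Diff_if)
  note d = Z[unfolded delta_o_def prod.case mem_Collect_eq 1 2 3 4 5 6 7]
  from subset_primary[OF A] d show ?thesis
    by (elim insertE; simp add: add_ac)
qed

text \<open>Users 1 and 2 lie outside \<open>?B\<close> and are averaged out, in accordance with
  informations that do not condition on \<open>X1\<close> or \<open>X2\<close>.\<close>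

lemma (in information_space) secondary_rates:
  assumes meas: "Q \<in> M \<rightarrow>\<^sub>M count_space UNIV" "U \<in> M \<rightarrow>\<^sub>M count_space UNIV" "W \<in> M \<rightarrow>\<^sub>M count_space UNIV"
     "X1 \<in> M \<rightarrow>\<^sub>M count_space UNIV" "X2 \<in> M \<rightarrow>\<^sub>M count_space UNIV" "Ys \<in> M \<rightarrow>\<^sub>M count_space UNIV"
    and law: "distr M (count_space UNIV) (\<lambda>z. (Q z, encode (X1 z) (X2 z) (U z) (W z), Ys z)) =
      measure_pmf (multiple_access.joint PQ PX V)"
    and Z: "(R1, R2, S, T) \<in> delta_o (Q, U, W, X1, X2, Xs, Yp, Ys)"
    and A: "A \<subseteq> {Private, Common}" "A \<noteq> {}"
  shows "(\<Sum>j\<in>A. case_user R1 R2 S T j) \<le> multiple_access.information PQ PX V b {Private, Common} A"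
proof -
  let ?B = "{Private, Common}"
  have G: "(\<lambda>z. (Q z, encode (X1 z) (X2 z) (U z) (W z), Ys z)) \<in> M \<rightarrow>\<^sub>M count_space UNIV"
    using measurable_compose[of "\<lambda>z. (Q z, X1 z, X2 z, U z, W z, Ys z)" M "count_space UNIV"
        "\<lambda>(q, x1, x2, u, w, y). (q, encode x1 x2 u w, y)" "count_space UNIV"] meas
    by simp
  note eq = conditional_mutual_information_eq_information[where B = ?B, OF _ meas(6) _ G law]
  have 1: "\<I>(Ys ; U | (\<lambda>z. (W z, Q z))) = multiple_access.information PQ PX V b ?B {Private}"
    using meas by (intro eq) (auto simp: insert_Diff_if)
  have 2: "\<I>(Ys ; W | (\<lambda>z. (U z, Q z))) = multiple_access.information PQ PX V b ?B {Common}"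
    using meas by (intro eq) (auto simp: insert_Diff_if)
  have 3: "\<I>(Ys ; (\<lambda>z. (U z, W z)) | Q) = multiple_access.information PQ PX V b ?B {Private, Common}"
    using meas by (intro eq) (auto simp: insert_Diff_if)
  note d = Z[unfolded delta_o_def prod.case mem_Collect_eq 1 2 3]
  from subset_secondary[OF A] d show ?thesis
    by (elim insertE; simp add: add_ac)
qed

lemma distr_joint_map:
  fixes b :: real
  assumes law: "distr M (count_space UNIV) (\<lambda>z. (Q z, L z, Y z)) = measure_pmf (multiple_access.joint PQ PX V)"
    and G: "(\<lambda>z. (Q z, L z, Y z)) \<in> M \<rightarrow>\<^sub>M count_space UNIV" and b: "1 < b"
  shows "distr M (count_space UNIV) (\<lambda>z. (Q z, L z, h (Y z))) =
    measure_pmf (multiple_access.joint PQ PX (\<lambda>q x. map_pmf h (V q x)))"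
proof -
  have "distr M (count_space UNIV) (\<lambda>z. (Q z, L z, h (Y z))) =
    distr (distr M (count_space UNIV) (\<lambda>z. (Q z, L z, Y z))) (count_space UNIV) (\<lambda>(q, x, y). (q, x, h y))"
    using G by (subst distr_distr) (auto simp: comp_def)
  also have "\<dots> = measure_pmf (map_pmf (\<lambda>(q, x, y). (q, x, h y)) (multiple_access.joint PQ PX V))"
    unfolding law by (simp add: map_pmf_rep_eq)
  finally show ?thesis by (simp only: map_pmf_joint[OF b])
qed

lemma sum_quadruple:
  "(\<Sum>i\<in>A. \<Sum>j\<in>B. \<Sum>k\<in>C. \<Sum>l\<in>D. f i j k l) = (\<Sum>(i, j, k, l)\<in>A \<times> B \<times> C \<times> D. f i j k l)"
  by (simp add: sum.cartesian_product)

text \<open>Some outcome makes the message average of \<open>ep + es\<close> at most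
  \<open>\<epsilon>\<close>; by nonnegativity this bounds each of the two averages.\<close>

lemma pigeonhole_codebook:
  fixes ep es :: "'c \<Rightarrow> 'k \<Rightarrow> real"
  assumes fin: "finite K" "K \<noteq> {}"
    and ep: "\<And>k. k \<in> K \<Longrightarrow> measure_pmf.expectation p (\<lambda>C. ep C k) \<le> \<epsilon>p"
    and es: "\<And>k. k \<in> K \<Longrightarrow> measure_pmf.expectation p (\<lambda>C. es C k) \<le> \<epsilon>s"
    and bounds: "\<And>C k. 0 \<le> ep C k \<and> ep C k \<le> 1" "\<And>C k. 0 \<le> es C k \<and> es C k \<le> 1"
    and small: "\<epsilon>p + \<epsilon>s < \<epsilon>"
  shows "\<exists>C. (\<Sum>k\<in>K. ep C k) / real (card K) \<le> \<epsilon> \<and> (\<Sum>k\<in>K. es C k) / real (card K) \<le> \<epsilon>"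
proof -
  have int: "integrable (measure_pmf p) (\<lambda>C. ep C k)" "integrable (measure_pmf p) (\<lambda>C. es C k)" for k
    using bounds by (auto intro!: measure_pmf.integrable_const_bound[where B = 1])
  have card: "0 < real (card K)" using fin by (simp add: card_gt_0_iff)
  have "measure_pmf.expectation p (\<lambda>C. (\<Sum>k\<in>K. ep C k + es C k) / real (card K)) =
    (\<Sum>k\<in>K. measure_pmf.expectation p (\<lambda>C. ep C k) + measure_pmf.expectation p (\<lambda>C. es C k)) / real (card K)"
    using int by (simp add: integral_sum)
  also have "\<dots> \<le> (\<Sum>k\<in>K. \<epsilon>p + \<epsilon>s) / real (card K)"
    using card by (intro divide_right_mono sum_mono add_mono ep es) auto
  also have "\<dots> < \<epsilon>" using card small by simp
  finally obtain C where C: "(\<Sum>k\<in>K. ep C k + es C k) / real (card K) \<le> \<epsilon>"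
    using exists_le_expectation_pmf[of p "\<lambda>C. (\<Sum>k\<in>K. ep C k + es C k) / real (card K)" \<epsilon>] int by auto
  have "(\<Sum>k\<in>K. ep C k) / real (card K) \<le> (\<Sum>k\<in>K. ep C k + es C k) / real (card K)"
    "(\<Sum>k\<in>K. es C k) / real (card K) \<le> (\<Sum>k\<in>K. ep C k + es C k) / real (card K)"
    using bounds card by (auto intro!: divide_right_mono sum_mono)
  with C show ?thesis by (intro exI[of _ C]) linarith
qed

theorem theorem1:
  fixes M :: "'a measure" and b :: real
    and \<omega> :: "('x1::finite, 'x2::finite, 'xs::finite, 'yp::finite, 'ys::finite) channel"
    and Z :: "('a \<Rightarrow> 'q::finite) \<times> ('a \<Rightarrow> 'u::finite) \<times> ('a \<Rightarrow> 'w::finite) \<times>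
              ('a \<Rightarrow> 'x1) \<times> ('a \<Rightarrow> 'x2) \<times> ('a \<Rightarrow> 'xs) \<times> ('a \<Rightarrow> 'yp) \<times> ('a \<Rightarrow> 'ys)"
  assumes "prob_space M" and "1 < b"
    and "Z \<in> P_star M \<omega>"
    and "(R1, R2, S, T) \<in> information_space.delta_o M b Z"
  shows "crs_achievable b \<omega> (R1, R2, S, T)"
proof -
  interpret information_space M b
    using assms(1,2) by (intro information_space.intro) (simp_all add: information_space_axioms_def)
  obtain Q U W X1 X2 Xs Y where "Z = (Q, U, W, X1, X2, Xs, Y)" by (cases Z)
  then obtain Yp Ys where Z: "Z = (Q, U, W, X1, X2, Xs, Yp, Ys)" by (cases Y) auto
  have meas: "Q \<in> M \<rightarrow>\<^sub>M count_space UNIV" "U \<in> M \<rightarrow>\<^sub>M count_space UNIV" "W \<in> M \<rightarrow>\<^sub>M count_space UNIV"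
     "X1 \<in> M \<rightarrow>\<^sub>M count_space UNIV" "X2 \<in> M \<rightarrow>\<^sub>M count_space UNIV"
     "Yp \<in> M \<rightarrow>\<^sub>M count_space UNIV" "Ys \<in> M \<rightarrow>\<^sub>M count_space UNIV"
    using assms(3) by (simp_all add: Z P_star_def)
  obtain PQ PX f where law: "distr M (count_space UNIV)
      (\<lambda>z. (Q z, encode (X1 z) (X2 z) (U z) (W z), (Yp z, Ys z))) =
      measure_pmf (multiple_access.joint PQ PX (\<lambda>q. decode (\<lambda>x1 x2 u w. \<omega> x1 x2 (f q u w))))"
    using P_star_law[OF assms(3)[unfolded Z] b_gt_1] by blast
  have G: "(\<lambda>z. (Q z, encode (X1 z) (X2 z) (U z) (W z), (Yp z, Ys z))) \<in> M \<rightarrow>\<^sub>M count_space UNIV"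
    using measurable_compose[of "\<lambda>z. (Q z, X1 z, X2 z, U z, W z, Yp z, Ys z)" M "count_space UNIV"
        "\<lambda>(q, x1, x2, u, w, y). (q, encode x1 x2 u w, y)" "count_space UNIV"] meas
    by simp
  define Vp where "Vp = (\<lambda>q. decode (\<lambda>x1 x2 u w. channel_p \<omega> x1 x2 (f q u w)))"
  define Vs where "Vs = (\<lambda>q. decode (\<lambda>x1 x2 u w. channel_s \<omega> x1 x2 (f q u w)))"
  have Vp: "(\<lambda>q x. map_pmf fst (decode (\<lambda>x1 x2 u w. \<omega> x1 x2 (f q u w)) x)) = Vp"
    by (simp add: Vp_def decode_def channel_p_def fun_eq_iff)
  have law_p: "distr M (count_space UNIV) (\<lambda>z. (Q z, encode (X1 z) (X2 z) (U z) (W z), Yp z)) =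
      measure_pmf (multiple_access.joint PQ PX Vp)"
    using distr_joint_map[OF law G b_gt_1, of fst] by (simp add: Vp)
  have Vs: "(\<lambda>q x. map_pmf snd (decode (\<lambda>x1 x2 u w. \<omega> x1 x2 (f q u w)) x)) = Vs"
    by (simp add: Vs_def decode_def channel_s_def fun_eq_iff)
  have law_s: "distr M (count_space UNIV) (\<lambda>z. (Q z, encode (X1 z) (X2 z) (U z) (W z), Ys z)) =
      measure_pmf (multiple_access.joint PQ PX Vs)"
    using distr_joint_map[OF law G b_gt_1, of snd] by (simp add: Vs)
  interpret p: multiple_access PQ PX Vp b using b_gt_1 by unfold_locales
  interpret s: multiple_access PQ PX Vs b using b_gt_1 by unfold_locales
  let ?Bp = "{First, Second, Common}" and ?Bs = "{Private, Common}"
  define \<rho> where "\<rho> = case_user R1 R2 S T"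
  have region: "(R1, R2, S, T) \<in> delta_o (Q, U, W, X1, X2, Xs, Yp, Ys)"
    using assms(4) unfolding Z .
  have rates_p: "(\<Sum>j\<in>A. \<rho> j) \<le> p.information ?Bp A" if "A \<subseteq> ?Bp" "A \<noteq> {}" for A
    unfolding \<rho>_def by (rule primary_rates[OF meas(1-6) law_p region that])
  have rates_s: "(\<Sum>j\<in>A. \<rho> j) \<le> s.information ?Bs A" if "A \<subseteq> ?Bs" "A \<noteq> {}" for A
    unfolding \<rho>_def by (rule secondary_rates[OF meas(1-5,7) law_s region that])
  have code: "\<forall>\<^sub>F n in sequentially.
         \<exists>M1 M2 Ls Ns x1 x2 xs Dp Ds.
           is_crs_code \<omega> n M1 M2 Ls Ns \<epsilon> x1 x2 xs Dp Ds \<and>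
           log b (real M1) / real n \<ge> R1 - \<eta> \<and>
           log b (real M2) / real n \<ge> R2 - \<eta> \<and>
           log b (real Ls) / real n \<ge> S - \<eta> \<and>
           log b (real Ns) / real n \<ge> T - \<eta>"
    if \<eta>: "0 < \<eta>" and \<epsilon>: "0 < \<epsilon>" for \<eta> \<epsilon> :: real
  proof -
    let ?Dp = "\<lambda>n. p.decoding_set (\<eta> / 2) n ?Bp" and ?Ds = "\<lambda>n. s.decoding_set (\<eta> / 2) n ?Bs"
    obtain ep where ep: "ep \<longlonglongrightarrow> 0" "\<And>n N m. (\<And>j. real (N j - 1) \<le> b powr (real n * (\<rho> j - \<eta>))) \<Longrightarrow>
        (\<And>j. m j \<in> {1..N j}) \<Longrightarrow> measure_pmf.expectation (p.codebook n N)
          (\<lambda>C. measure_pmf.prob (p.outputs n C m) (- ?Dp n N C m)) \<le> ep n"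
      using p.random_coding[of ?Bp \<rho> \<eta>] rates_p \<eta> by blast
    obtain es where es: "es \<longlonglongrightarrow> 0" "\<And>n N m. (\<And>j. real (N j - 1) \<le> b powr (real n * (\<rho> j - \<eta>))) \<Longrightarrow>
        (\<And>j. m j \<in> {1..N j}) \<Longrightarrow> measure_pmf.expectation (s.codebook n N)
          (\<lambda>C. measure_pmf.prob (s.outputs n C m) (- ?Ds n N C m)) \<le> es n"
      using s.random_coding[of ?Bs \<rho> \<eta>] rates_s \<eta> by blast
    have "(\<lambda>n. ep n + es n) \<longlonglongrightarrow> 0" using tendsto_add[OF ep(1) es(1)] by simp
    then have "\<forall>\<^sub>F n in sequentially. ep n + es n < \<epsilon>" using \<epsilon> by (rule order_tendstoD)
    then show ?thesis using eventually_gt_at_top[of 0]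
    proof eventually_elim
      case (elim n)
      \<comment> \<open>Rounding up secures the rate and, as the power is positive, at least one
        message, even when \<open>\<rho> j < \<eta>\<close>; \<open>N j - 1\<close> still respects
        the bound in \<open>random_coding\<close>.\<close>
      define N where "N = (\<lambda>j. nat \<lceil>b powr (real n * (\<rho> j - \<eta>))\<rceil>)"
      have pos: "0 < b powr (real n * (\<rho> j - \<eta>))" for j using b_gt_1 by simp
      have N_ge_1: "1 \<le> N j" for j
        using pos[of j] unfolding N_def by linarith
      have N_le: "real (N j - 1) \<le> b powr (real n * (\<rho> j - \<eta>))" for j
        using N_ge_1[of j] pos[of j] unfolding N_def by linarith
      have N_rate: "\<rho> j - \<eta> \<le> log b (real (N j)) / real n" for j
      proof -
        have "b powr (real n * (\<rho> j - \<eta>)) \<le> real (N j)"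
          unfolding N_def using pos[of j] by linarith
        then have "log b (b powr (real n * (\<rho> j - \<eta>))) \<le> log b (real (N j))"
          using b_gt_1 pos by (intro log_mono) auto
        then show ?thesis using elim b_gt_1 by (simp add: field_simps)
      qed
      let ?K = "{1..N First} \<times> {1..N Second} \<times> {1..N Private} \<times> {1..N Common}"
      let ?m = "\<lambda>(i, j, k, l). message i j k l"
      let ?ep = "\<lambda>C m. measure_pmf.prob (p.outputs n C m) (- ?Dp n N C m)"
      let ?es = "\<lambda>C m. measure_pmf.prob (s.outputs n C m) (- ?Ds n N C m)"
      have m: "?m r j \<in> {1..N j}" if "r \<in> ?K" for r j
        using that by (cases j) auto
      have "\<exists>C. (\<Sum>r\<in>?K. ?ep C (?m r)) / real (card ?K) \<le> \<epsilon> \<and> (\<Sum>r\<in>?K. ?es C (?m r)) / real (card ?K) \<le> \<epsilon>"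
      proof (rule pigeonhole_codebook[where p = "p.codebook n N"])
        show "measure_pmf.expectation (p.codebook n N) (\<lambda>C. ?ep C (?m r)) \<le> ep n" if "r \<in> ?K" for r
          using N_le m[OF that] by (rule ep(2))
        \<comment> \<open>The law of the codebook does not involve the channel, so \<open>p\<close>
          and \<open>s\<close> share it.\<close>
        show "measure_pmf.expectation (p.codebook n N) (\<lambda>C. ?es C (?m r)) \<le> es n" if "r \<in> ?K" for r
          using N_le m[OF that] by (rule es(2))
        show "?K \<noteq> {}" using N_ge_1 by simp
      qed (use elim in auto)
      then obtain C where
        err_p: "(\<Sum>r\<in>?K. ?ep C (?m r)) / real (card ?K) \<le> \<epsilon>" and
        err_s: "(\<Sum>r\<in>?K. ?es C (?m r)) / real (card ?K) \<le> \<epsilon>" by blast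
      define c where "c = (\<lambda>t. snd (C t))"
      \<comment> \<open>The projections are those of \<open>decode\<close>, so the letters agree in
        whatever summand they lie. Beyond \<open>n\<close> the value is \<open>undefined\<close>, as
        \<open>words\<close> requires.\<close>
      define x1 where "x1 = (\<lambda>i t. if t < n then projl (c t First i) else undefined)"
      define x2 where "x2 = (\<lambda>j t. if t < n then projl (projr (c t Second j)) else undefined)"
      \<comment> \<open>The letter of \<open>Q\<close> at each time is fixed along with the
        codebook, so the secondary encoder may use it.\<close>
      define xs where "xs = (\<lambda>k l t. if t < n then f (fst (C t)) (projl (projr (projr (c t Private k))))
          (projr (projr (projr (c t Common l)))) else undefined)"
      \<comment> \<open>The index 1 fills the places of messages that the receiver does not decode;
        it is a valid index since every \<open>N j\<close> is at least 1.\<close>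
      define Dp where "Dp = (\<lambda>i j l. ?Dp n N C (message i j 1 l))"
      define Ds where "Ds = (\<lambda>k l. ?Ds n N C (message 1 1 k l))"
      have out_p: "memoryless n (channel_p \<omega>) (x1 i) (x2 j) (xs k l) = p.outputs n C (message i j k l)" for i j k l
        unfolding memoryless_def p.outputs_def
        by (intro Pi_pmf_cong) (simp_all add: x1_def x2_def xs_def c_def Vp_def decode_def p.select_def)
      have out_s: "memoryless n (channel_s \<omega>) (x1 i) (x2 j) (xs k l) = s.outputs n C (message i j k l)" for i j k l
        unfolding memoryless_def s.outputs_def
        by (intro Pi_pmf_cong) (simp_all add: x1_def x2_def xs_def c_def Vs_def decode_def s.select_def)
      have Dp: "Dp i j l = ?Dp n N C (message i j k l)" for i j k l
        unfolding Dp_def by (rule p.decoding_set_cong) auto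
      have Ds: "Ds k l = ?Ds n N C (message i j k l)" for i j k l
        unfolding Ds_def by (rule s.decoding_set_cong) auto
      have card: "real (card ?K) = real (N First) * real (N Second) * real (N Private) * real (N Common)"
        by (simp add: card_cartesian_product)
      have "is_crs_code \<omega> n (N First) (N Second) (N Private) (N Common) \<epsilon> x1 x2 xs Dp Ds"
        unfolding is_crs_code_def
      proof (intro conjI ballI)
        show "x1 i \<in> words n" for i by (auto simp: words_def x1_def split: if_splits)
        show "x2 j \<in> words n" for j by (auto simp: words_def x2_def split: if_splits)
        show "xs k l \<in> words n" for k l by (auto simp: words_def xs_def split: if_splits)
        show "Dp i j l \<subseteq> words n" for i j l by (auto simp: Dp_def p.decoding_set_def)
        show "Ds k l \<subseteq> words n" for k l by (auto simp: Ds_def s.decoding_set_def)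
        show "disjoint_family_on (\<lambda>(i, j, l). Dp i j l) ({1..N First} \<times> {1..N Second} \<times> {1..N Common})"
          unfolding disjoint_family_on_def
        proof (intro ballI impI)
          fix r r'
          assume r: "r \<in> {1..N First} \<times> {1..N Second} \<times> {1..N Common}"
            "r' \<in> {1..N First} \<times> {1..N Second} \<times> {1..N Common}" "r \<noteq> r'"
          obtain i j l i' j' l' where [simp]: "r = (i, j, l)" "r' = (i', j', l')"
            by (cases r, cases r')
          have "Dp i j l \<inter> Dp i' j' l' = {}"
            unfolding Dp_def using r m[of "(i, j, 1, l)"] m[of "(i', j', 1, l')"] N_ge_1
            by (intro p.decoding_set_disjoint) auto
          then show "(case r of (i, j, l) \<Rightarrow> Dp i j l) \<inter> (case r' of (i, j, l) \<Rightarrow> Dp i j l) = {}" by simp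
        qed
        show "disjoint_family_on (\<lambda>(k, l). Ds k l) ({1..N Private} \<times> {1..N Common})"
          unfolding disjoint_family_on_def
        proof (intro ballI impI)
          fix r r'
          assume r: "r \<in> {1..N Private} \<times> {1..N Common}" "r' \<in> {1..N Private} \<times> {1..N Common}" "r \<noteq> r'"
          obtain k l k' l' where [simp]: "r = (k, l)" "r' = (k', l')"
            by (cases r, cases r')
          have "Ds k l \<inter> Ds k' l' = {}"
            unfolding Ds_def using r m[of "(1, 1, k, l)"] m[of "(1, 1, k', l')"] N_ge_1
            by (intro s.decoding_set_disjoint) auto
          then show "(case r of (k, l) \<Rightarrow> Ds k l) \<inter> (case r' of (k, l) \<Rightarrow> Ds k l) = {}" by simp
        qed
        have "(\<Sum>i=1..N First. \<Sum>j=1..N Second. \<Sum>k=1..N Private. \<Sum>l=1..N Common.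
            measure_pmf.prob (memoryless n (channel_p \<omega>) (x1 i) (x2 j) (xs k l)) (- Dp i j l)) =
            (\<Sum>r\<in>?K. ?ep C (?m r))"
          unfolding sum_quadruple out_p
          by (intro sum.cong refl) (auto simp flip: Dp)
        with err_p show "(\<Sum>i=1..N First. \<Sum>j=1..N Second. \<Sum>k=1..N Private. \<Sum>l=1..N Common.
            measure_pmf.prob (memoryless n (channel_p \<omega>) (x1 i) (x2 j) (xs k l)) (- Dp i j l)) /
            (real (N First) * real (N Second) * real (N Private) * real (N Common)) \<le> \<epsilon>"
          unfolding card by simp
        have "(\<Sum>i=1..N First. \<Sum>j=1..N Second. \<Sum>k=1..N Private. \<Sum>l=1..N Common.
            measure_pmf.prob (memoryless n (channel_s \<omega>) (x1 i) (x2 j) (xs k l)) (- Ds k l)) =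
            (\<Sum>r\<in>?K. ?es C (?m r))"
          unfolding sum_quadruple out_s
          by (intro sum.cong refl) (auto simp flip: Ds)
        with err_s show "(\<Sum>i=1..N First. \<Sum>j=1..N Second. \<Sum>k=1..N Private. \<Sum>l=1..N Common.
            measure_pmf.prob (memoryless n (channel_s \<omega>) (x1 i) (x2 j) (xs k l)) (- Ds k l)) /
            (real (N First) * real (N Second) * real (N Private) * real (N Common)) \<le> \<epsilon>"
          unfolding card by simp
      qed (rule N_ge_1)+
      moreover have "R1 - \<eta> \<le> log b (real (N First)) / real n" "R2 - \<eta> \<le> log b (real (N Second)) / real n"
        "S - \<eta> \<le> log b (real (N Private)) / real n" "T - \<eta> \<le> log b (real (N Common)) / real n"
        using N_rate[of First] N_rate[of Second] N_rate[of Private] N_rate[of Common] by (simp_all add: \<rho>_def)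
      ultimately show ?case by blast
    qed
  qed
  have "0 \<le> R1" "0 \<le> R2" "0 \<le> S" "0 \<le> T" using region by (auto simp: delta_o_def)
  with code show ?thesis by (simp add: crs_achievable_def)
qed

end
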